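(* There is a bijection between balanced blossom trees of total charge $2$ and $2$-leg maps. Moreover this bijection preserves the degree distribution $(\lambda,\mu)$.
   Context: All maps are planar, considered up to orientation-preserving homeomorphism, bipartite (vertices colored white and black, every edge joining a white vertex to a black vertex), and may additionally carry half-edges (edges incident to only one vertex) lying in the infinite face when drawn in the plane; each map is rooted at one of these half-edges, and the vertex incident to the root half-edge is the root vertex. Half-edges attached to black vertices are called buds; half-edges attached to white vertices are called leaves. The degree of a vertex counts the half-edges attached to it. The degree distribution of a map is the pair of partitions $(\lambda,\mu)$, where $\lambda$ records the degrees of the white vertices and $\mu$ the degrees of the black vertices. A $k$-leg map is such a map with exactly $k$ leaves and no bud (so it is rooted at one of its leaves). A tree is such a map with only one face. The total charge of a tree is (number of leaves) minus (number of buds), the root half-edge included; its charge is the same difference with the root half-edge not counted. For an edge $e$ of a tree $T$, cutting $e$ into two half-edges gives two subtrees rooted at these half-edges: $T^\bullet_e$ contains the black endpoint of $e$ and $T^\circ_e$ the white one; the one not containing the root of $T$ is the lower subtree at $e$. The black charge rule holds at $e$ if $T^\bullet_e$ has charge at most $1$; the white charge rule holds at $e$ if $T^\circ_e$ has nonnegative charge. A blossom tree is a tree in which every lower subtree satisfies the charge rule corresponding to the color of its root vertex's side (i.e. if the lower subtree is $T^\bullet_e$ it has charge $\le 1$, if it is $T^\circ_e$ it has charge $\ge 0$). For a tree of total charge $k\ge 1$, list its half-edges cyclically counterclockwise around the tree and match buds with leaves as opening and closing brackets (repeatedly match a bud immediately followed by a leaf, discard matched pairs, and repeat); $k$ leaves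 remain unmatched, called single leaves. A tree rooted at a leaf is balanced if its root leaf is single. The closure of a balanced tree fuses each matched bud–leaf pair into an edge, yielding a $k$-leg map with the same degree distribution. *)

theory Defs
  imports "HOL-Combinatorics.Combinatorics" "HOL-Combinatorics.Orbits"
begin

text \<open>
  A map on an oriented surface is encoded by its rotation system. A dart is an incidence of an
  edge or half-edge with a vertex; \<open>rot\<close> sends a dart to the next one counterclockwise around its
  vertex, and \<open>opp\<close> sends a dart to the other dart of its edge. The fixed points of \<open>opp\<close> are the
  dangling half-edges. \<open>white\<close> is the set of darts at white vertices; the other darts are black.
\<close>

record bmap =
  darts :: "nat set"
  rot :: "nat \<Rightarrow> nat"
  opp :: "nat \<Rightarrow> nat"
  white :: "nat set"
  root_dart :: nat

definition half_edges :: "bmap \<Rightarrow> nat set" where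
  "half_edges M = {d \<in> darts M. opp M d = d}"

definition leaves :: "bmap \<Rightarrow> nat set" where
  "leaves M = half_edges M \<inter> white M"

definition buds :: "bmap \<Rightarrow> nat set" where
  "buds M = half_edges M - white M"

definition vertices :: "bmap \<Rightarrow> nat set set" where
  "vertices M = orbit (rot M) ` darts M"

definition edges :: "bmap \<Rightarrow> nat set set" where
  "edges M = {{d, opp M d} | d. d \<in> darts M \<and> opp M d \<noteq> d}"

text \<open>
  Starting from a dart, cross its edge and turn counterclockwise to the next dart. This walks along
  the boundary of the face to the right of the dart, and in a plane tree it is the counterclockwise
  walk around the tree. At a half-edge \<open>opp\<close> is the identity, so the walk goes around the half-edge
  and stays in the same face.
\<close>
definition contour :: "bmap \<Rightarrow> nat \<Rightarrow> nat" where
  "contour M = rot M \<circ> opp M"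

definition faces :: "bmap \<Rightarrow> nat set set" where
  "faces M = orbit (contour M) ` darts M"

definition component :: "bmap \<Rightarrow> nat \<Rightarrow> nat set" where
  "component M d =
    {x. (d, x) \<in> ({(y, rot M y) | y. y \<in> darts M} \<union> {(y, opp M y) | y. y \<in> darts M})\<^sup>*}"

definition connected_map :: "bmap \<Rightarrow> bool" where
  "connected_map M \<longleftrightarrow> (\<forall>d\<in>darts M. component M d = darts M)"

text \<open>
  Planarity is Euler's formula. The infinite face is the one containing the root half-edge, so
  the last condition says that all half-edges lie in the infinite face. There are no vertices
  of degree zero, since a rooted connected map cannot contain one.
\<close>
definition bipartite_map :: "bmap \<Rightarrow> bool" where
  "bipartite_map M \<longleftrightarrow>
     finite (darts M) \<and>
     rot M permutes darts M \<and>
     opp M permutes darts M \<and> (\<forall>d. opp M (opp M d) = d) \<and>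
     white M \<subseteq> darts M \<and>
     (\<forall>d\<in>darts M. rot M d \<in> white M \<longleftrightarrow> d \<in> white M) \<and>
     (\<forall>d\<in>darts M. opp M d \<noteq> d \<longrightarrow> (opp M d \<in> white M \<longleftrightarrow> d \<notin> white M)) \<and>
     connected_map M \<and>
     card (vertices M) + card (faces M) = card (edges M) + 2 \<and>
     root_dart M \<in> half_edges M \<and>
     half_edges M \<subseteq> orbit (contour M) (root_dart M)"

text \<open>
  Rooted orientation-preserving homeomorphism. Relating only genuine maps keeps
  ill-formed records out of the equivalence classes.
\<close>
definition map_iso :: "(bmap \<times> bmap) set" where
  "map_iso = {(M, N). bipartite_map M \<and> bipartite_map N \<and>
     (\<exists>f. bij_betw f (darts M) (darts N) \<and>
        (\<forall>d\<in>darts M. f (rot M d) = rot N (f d) \<and> f (opp M d) = opp N (f d) \<and>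
                     (f d \<in> white N \<longleftrightarrow> d \<in> white M)) \<and>
        f (root_dart M) = root_dart N)}"

text \<open>The pair of partitions, as multisets of positive integers.\<close>
definition degree_distribution :: "bmap \<Rightarrow> nat multiset \<times> nat multiset" where
  "degree_distribution M =
     (image_mset card (mset_set {v \<in> vertices M. v \<subseteq> white M}),
      image_mset card (mset_set {v \<in> vertices M. v \<inter> white M = {}}))"

definition leg_map :: "nat \<Rightarrow> bmap \<Rightarrow> bool" where
  "leg_map k M \<longleftrightarrow> bipartite_map M \<and> card (leaves M) = k \<and> buds M = {}"

definition plane_tree :: "bmap \<Rightarrow> bool" where
  "plane_tree T \<longleftrightarrow> bipartite_map T \<and> card (faces T) = 1"

definition total_charge :: "bmap \<Rightarrow> int" where
  "total_charge T = int (card (leaves T)) - int (card (buds T))"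

definition charge :: "bmap \<Rightarrow> int" where
  "charge T = int (card (leaves T - {root_dart T})) - int (card (buds T - {root_dart T}))"

definition cut :: "bmap \<Rightarrow> nat \<Rightarrow> bmap" where
  "cut T d = T\<lparr>opp := (opp T)(d := d, opp T d := opp T d)\<rparr>"

text \<open>
  The subtree containing \<open>d\<close> after cutting the edge of \<open>d\<close>, rooted at the half-edge \<open>d\<close>: it is
  the white subtree at that edge if \<open>d\<close> is white, and the black subtree otherwise.
\<close>
definition subtree :: "bmap \<Rightarrow> nat \<Rightarrow> bmap" where
  "subtree T d = (let S = component (cut T d) d in
     \<lparr>darts = S, rot = perm_restrict (rot T) S, opp = perm_restrict (opp (cut T d)) S,
      white = white T \<inter> S, root_dart = d\<rparr>)"

definition charge_rule :: "bmap \<Rightarrow> nat \<Rightarrow> bool" where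
  "charge_rule T d \<longleftrightarrow>
     (if d \<in> white T then charge (subtree T d) \<ge> 0 else charge (subtree T d) \<le> 1)"

definition blossom_tree :: "bmap \<Rightarrow> bool" where
  "blossom_tree T \<longleftrightarrow> plane_tree T \<and>
     (\<forall>d\<in>darts T. opp T d \<noteq> d \<and> root_dart T \<notin> darts (subtree T d) \<longrightarrow> charge_rule T d)"

text \<open>The half-edges met strictly between \<open>b\<close> and \<open>l\<close>, going counterclockwise from \<open>b\<close> to \<open>l\<close>.\<close>
definition between :: "bmap \<Rightarrow> nat \<Rightarrow> nat \<Rightarrow> nat set" where
  "between T b l = half_edges T \<inter>
     {(contour T ^^ n) b | n. 0 < n \<and> n < funpow_dist1 (contour T) b l}"

text \<open>
  A bud is matched with a leaf once every half-edge between them has been discarded. The partner of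
  such a half-edge must itself lie between them: neither the bud nor the leaf is discarded yet, and
  pairs are adjacent when they are discarded, so no pair can straddle either of them.
\<close>
inductive matched :: "bmap \<Rightarrow> nat \<Rightarrow> nat \<Rightarrow> bool" for T where
  "b \<in> buds T \<Longrightarrow> l \<in> leaves T \<Longrightarrow>
   \<forall>h\<in>between T b l. \<exists>h'\<in>between T b l. matched T h h' \<or> matched T h' h \<Longrightarrow>
   matched T b l"

definition single_leaves :: "bmap \<Rightarrow> nat set" where
  "single_leaves T = {l \<in> leaves T. \<not> (\<exists>b. matched T b l)}"

definition balanced :: "bmap \<Rightarrow> bool" where
  "balanced T \<longleftrightarrow> root_dart T \<in> single_leaves T"

definition balanced_blossom_trees :: "int \<Rightarrow> bmap set set" where
  "balanced_blossom_trees k =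
     {T. blossom_tree T \<and> balanced T \<and> total_charge T = k} // map_iso"

definition leg_maps :: "nat \<Rightarrow> bmap set set" where
  "leg_maps k = {M. leg_map k M} // map_iso"

end

theory Submission
  imports Defs
begin

text \<open>
  The closure keeps the darts and their rotation and only changes \<open>opp\<close> at the matched pairs, so it
  suffices to show that every 2-leg map is the closure of exactly one balanced blossom tree.

  Walk counterclockwise around a tree from its second single leaf \<open>s\<close>, and let the height of a dart be
  the number of matched pairs that enclose it. The height is constant on the faces of the closure, and
  the charge rule at an edge with black dart \<open>x\<close> and white dart \<open>y\<close> says that \<open>y\<close> exceeds the height
  of \<open>x\<close> by at most one, and not at all if the walk meets \<open>x\<close> first. Hence the height of a face is its
  distance from the outer face in the dual of the closure, where edges may only be crossed from black
  to white. So trees with the same closure have the same heights, and the walks around them cannot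
  diverge: where they first did, one tree would keep an edge that the other cuts, against its charge
  rule.

  Conversely, cut a 2-leg map along one edge into each inner face that ends a shortest dual path. This
  always gives a balanced tree whose closure is the map. If the charge rule fails at an edge, then
  entering its face through this edge instead makes the sequence of distances met by the walk
  lexicographically larger; so it holds everywhere for the lexicographically maximal sequence.
\<close>

section \<open>Positions on a cyclic walk, and distances\<close>

text \<open>The base point matters. In a walk from the root, the lower subtree is always an interval
  of the walk, and its charge rule as an inequality of heights would depend on whether it holds the
  other single leaf. In a walk from \<open>s\<close>, the interval may be the lower or the upper
  side. The charges of the two sides add up to 2 and the root leaf contributes 1, so both cases give
  the same inequality, which depends only on which end of the edge is met first.

  Distances alone do not determine the tree, since several edges may enter a face along shortest
  dual paths. The order of the walk breaks the tie: an edge that raises the distance may stay uncut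
  only if its white dart is met first. This is circular, as the order depends on the cuts. For
  uniqueness the circle is broken by comparing two walks up to their first divergence. For
  existence, repairing one edge changes the walk and may spoil others, so a potential is needed. The
  sequence of distances serves because a repair leaves the walk unchanged up to the black dart of
  the repaired edge and raises the distance met right after it.\<close>

locale cyclic_walk =
  fixes f :: "'a \<Rightarrow> 'a" and D :: "'a set" and q :: 'a
  assumes finite_D: "finite D" and permutes_D: "f permutes D"
    and base_in: "q \<in> D" and orbit_base: "orbit f q = D"
begin

definition pos :: "'a \<Rightarrow> nat" where
  "pos x = funpow_dist f q x"

lemma step_in [simp]: "f x \<in> D \<longleftrightarrow> x \<in> D"
  using permutes_D by (rule permutes_in_image)

lemma funpow_in [simp]: "(f ^^ n) x \<in> D \<longleftrightarrow> x \<in> D"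
  by (induction n) auto

lemma permutation_f: "permutation f"
  using finite_D permutes_D by (auto simp: permutation_permutes)

lemma inj_f: "f x = f y \<longleftrightarrow> x = y"
  using permutes_inj[OF permutes_D] by (auto dest: injD)

lemma orbit_eq: "x \<in> D \<Longrightarrow> orbit f x = D"
  using cyclic_on_orbit'[OF permutation_f, of q] unfolding orbit_base cyclic_on_alldef by auto

lemma funpow_pos [simp]: "x \<in> D \<Longrightarrow> (f ^^ pos x) q = x"
  unfolding pos_def by (rule funpow_dist_prop) (simp add: orbit_base)

lemma pos_le: "(f ^^ n) q = x \<Longrightarrow> pos x \<le> n"
  unfolding pos_def funpow_dist_def by (rule Least_le)

lemma pos_inj: "x \<in> D \<Longrightarrow> y \<in> D \<Longrightarrow> pos x = pos y \<longleftrightarrow> x = y"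
  by (metis funpow_pos)

lemma pos_base [simp]: "pos q = 0"
  using pos_le[of 0 q] by simp

lemma pos_eq_0: "x \<in> D \<Longrightarrow> pos x = 0 \<longleftrightarrow> x = q"
  using pos_inj[of x q] base_in by simp

lemma pos_step:
  assumes "x \<in> D" "f x \<noteq> q"
  shows "pos (f x) = Suc (pos x)"
proof (rule antisym)
  show "pos (f x) \<le> Suc (pos x)"
    using assms by (intro pos_le) simp
  have *: "(f ^^ pos (f x)) q = f x" using assms by simp
  then obtain k where k: "pos (f x) = Suc k"
    using assms(2) by (cases "pos (f x)") auto
  with * have "(f ^^ k) q = x" by (simp add: inj_f)
  then show "Suc (pos x) \<le> pos (f x)" using pos_le k by auto
qed

text \<open>If step \<open>i\<close> landed on an element of smaller position, the steps in between
  could be skipped and \<open>y\<close> would be reached in fewer than \<open>pos y\<close>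
  steps.\<close>

lemma pos_funpow:
  assumes "y \<in> D" "i \<le> pos y"
  shows "pos ((f ^^ i) q) = i"
proof (rule ccontr)
  let ?j = "pos ((f ^^ i) q)"
  assume "?j \<noteq> i"
  then have lt: "?j < i" using pos_le[of i] by (simp add: order.not_eq_order_implies_strict)
  have "(f ^^ (pos y - i + ?j)) q = (f ^^ (pos y - i)) ((f ^^ i) q)"
    using base_in by (simp add: funpow_add)
  also have "\<dots> = (f ^^ (pos y - i + i)) q"
    by (simp only: funpow_add o_apply)
  also have "\<dots> = y" using assms by simp
  finally have "pos y \<le> pos y - i + ?j" by (rule pos_le)
  with lt assms(2) show False by simp
qed

lemma pos_last:
  assumes "f x = q" "x \<in> D" "y \<in> D"
  shows "pos y \<le> pos x"
proof (rule ccontr)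
  assume "\<not> pos y \<le> pos x"
  then have "Suc (pos x) \<le> pos y" by simp
  from pos_funpow[OF assms(3) this] assms show False by simp
qed

lemma pos_less_card: "x \<in> D \<Longrightarrow> pos x < card D"
proof -
  assume x: "x \<in> D"
  have "inj_on (\<lambda>i. (f ^^ i) q) {..pos x}"
    by (intro inj_onI) (metis atMost_iff pos_funpow x)
  moreover have "(\<lambda>i. (f ^^ i) q) ` {..pos x} \<subseteq> D" using base_in by auto
  ultimately have "card {..pos x} \<le> card D" using finite_D by (rule card_inj_on_le)
  then show ?thesis by simp
qed

text \<open>Pigeonhole: a repetition at step \<open>i\<close> would confine all positions to values
  below \<open>i < card D\<close>, while \<open>pos\<close> is injective on
  \<open>D\<close>.\<close>

lemma pos_funpow_less_card:
  assumes "i < card D"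
  shows "pos ((f ^^ i) q) = i"
proof (rule ccontr)
  assume ne: "pos ((f ^^ i) q) \<noteq> i"
  have "pos x < i" if "x \<in> D" for x
    using pos_funpow[OF that, of i] ne by force
  then have "pos ` D \<subseteq> {..<i}" by auto
  then have "card (pos ` D) \<le> i" using card_mono[of "{..<i}"] by force
  moreover have "inj_on pos D" using pos_inj by (auto intro: inj_onI)
  ultimately show False using assms by (simp add: card_image)
qed

lemma pred_ex: "x \<in> D \<Longrightarrow> \<exists>y\<in>D. f y = x"
  using permutes_D by (metis permutes_def permutes_in_image)

lemma funpow_from: "x \<in> D \<Longrightarrow> (f ^^ n) x = (f ^^ (n + pos x)) q"
  by (simp add: funpow_add)

abbreviation strictly_between :: "'a \<Rightarrow> 'a \<Rightarrow> 'a set" where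
  "strictly_between x y \<equiv> {(f ^^ n) x | n. 0 < n \<and> n < funpow_dist1 f x y}"

lemma strictly_between_forward:
  assumes "x \<in> D" "y \<in> D" "pos x < pos y"
  shows "strictly_between x y = {z \<in> D. pos x < pos z \<and> pos z < pos y}"
proof -
  let ?d = "pos y - pos x"
  have pn: "pos ((f ^^ n) x) = pos x + n" if "n \<le> ?d" for n
    using that assms pos_funpow[of y "n + pos x"] by (simp add: funpow_from)
  have "(f ^^ ?d) x = y" using assms by (simp add: funpow_from)
  then have "\<not> ?d < funpow_dist1 f x y"
    using funpow_dist1_least[of ?d f x y] assms by linarith
  moreover have "(f ^^ funpow_dist1 f x y) x = y"
    using assms orbit_eq by (intro funpow_dist1_prop) auto
  then have "\<not> funpow_dist1 f x y < ?d"
    using pn[of "funpow_dist1 f x y"] by force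
  ultimately have d: "funpow_dist1 f x y = ?d" by simp
  show ?thesis unfolding d
  proof (intro set_eqI iffI)
    fix z assume "z \<in> {z \<in> D. pos x < pos z \<and> pos z < pos y}"
    then have z: "z \<in> D" "pos x < pos z" "pos z < pos y" by auto
    then have "(f ^^ (pos z - pos x)) x = z" using assms by (simp add: funpow_from)
    then show "z \<in> {(f ^^ n) x |n. 0 < n \<and> n < ?d}" using z
      by (intro CollectI exI[of _ "pos z - pos x"]) auto
  qed (use assms pn in auto)
qed

text \<open>This includes \<open>x = y\<close>, where \<open>funpow_dist1\<close> measures a full
  turn and everything else lies in between.\<close>

lemma strictly_between_wrap:
  assumes "x \<in> D" "y \<in> D" "pos y \<le> pos x"
  shows "strictly_between x y = {z \<in> D. pos x < pos z \<or> pos z < pos y}"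
proof -
  obtain w where w: "w \<in> D" "f w = q" using pred_ex base_in by blast
  \<comment> \<open>The predecessor \<open>w\<close> of the base point has the largest position, so
    \<open>N\<close> is the length of a full turn.\<close>
  define N where "N = Suc (pos w)"
  have N: "(f ^^ N) q = q" using w by (simp add: N_def)
  have posN: "pos z < N" if "z \<in> D" for z using pos_last[OF w(2,1) that] by (simp add: N_def)
  have p1: "pos ((f ^^ n) x) = pos x + n" if "pos x + n < N" for n
    using that assms pos_funpow[of w "n + pos x"] w by (simp add: funpow_from N_def)
  have p2: "(f ^^ (N - pos x + j)) x = (f ^^ j) q" for j
  proof -
    have "(f ^^ (N - pos x + j)) x = (f ^^ (j + N)) q"
      using posN[of x] assms by (simp add: funpow_from add.commute)
    then show ?thesis using N by (simp only: funpow_add o_apply)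
  qed
  have p3: "pos ((f ^^ n) x) = n + pos x - N" if "N \<le> n + pos x" "n + pos x - N \<le> pos y" for n
    using that p2[of "n + pos x - N"] posN[of x] assms pos_funpow[of y "n + pos x - N"] by simp
  let ?d = "N - pos x + pos y"
  have "(f ^^ ?d) x = y" using assms p2 by simp
  moreover have d0: "0 < ?d" using posN[of x] assms by simp
  ultimately have "\<not> ?d < funpow_dist1 f x y"
    using funpow_dist1_least[of ?d f x y] by linarith
  moreover have e: "(f ^^ funpow_dist1 f x y) x = y"
    using assms orbit_eq by (intro funpow_dist1_prop) auto
  have "\<not> funpow_dist1 f x y < ?d"
  proof
    assume lt: "funpow_dist1 f x y < ?d"
    show False
    proof (cases "pos x + funpow_dist1 f x y < N")
      case True
      from p1[OF this] e assms(3) show False by simp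
    next
      case False
      then have "N \<le> funpow_dist1 f x y + pos x" "funpow_dist1 f x y + pos x - N \<le> pos y"
        using lt posN[OF assms(1)] by linarith+
      from p3[OF this] show False unfolding e using lt False posN[OF assms(1)] by linarith
    qed
  qed
  ultimately have d: "funpow_dist1 f x y = ?d" by simp
  show ?thesis unfolding d
  proof (intro set_eqI iffI)
    fix z assume "z \<in> {z \<in> D. pos x < pos z \<or> pos z < pos y}"
    then have z: "z \<in> D" "pos x < pos z \<or> pos z < pos y" by auto
    show "z \<in> {(f ^^ n) x |n. 0 < n \<and> n < ?d}"
    proof (cases "pos x < pos z")
      case True
      then have "(f ^^ (pos z - pos x)) x = z" using z assms by (simp add: funpow_from)
      then show ?thesis using z True posN[of z]
        by (intro CollectI exI[of _ "pos z - pos x"]) auto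
    next
      case False
      then show ?thesis using z assms p2[of "pos z"] posN[of x]
        by (intro CollectI exI[of _ "N - pos x + pos z"]) auto
    qed
  next
    fix z assume "z \<in> {(f ^^ n) x |n. 0 < n \<and> n < ?d}"
    then obtain n where n: "z = (f ^^ n) x" "0 < n" "n < ?d" by blast
    then have "pos z < pos y" if "\<not> pos x + n < N"
      unfolding n(1) using p3[of n] posN[OF assms(1)] that n(3) by auto
    then show "z \<in> {z \<in> D. pos x < pos z \<or> pos z < pos y}"
      using n p1[of n] assms by (cases "pos x + n < N") auto
  qed
qed

end

section \<open>Distances between the orbits of a permutation\<close>

inductive reach :: "('a \<Rightarrow> 'a) \<Rightarrow> ('a \<Rightarrow> 'a) \<Rightarrow> 'a set \<Rightarrow> 'a \<Rightarrow> nat \<Rightarrow> 'a \<Rightarrow> bool"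
  for g j A r where
  start: "reach g j A r 0 r"
| turn: "reach g j A r n x \<Longrightarrow> reach g j A r n (g x)"
| jump: "reach g j A r n x \<Longrightarrow> x \<in> A \<Longrightarrow> reach g j A r (Suc n) (j x)"

definition level :: "('a \<Rightarrow> 'a) \<Rightarrow> ('a \<Rightarrow> 'a) \<Rightarrow> 'a set \<Rightarrow> 'a \<Rightarrow> 'a \<Rightarrow> nat" where
  "level g j A r x = (LEAST n. reach g j A r n x)"

text \<open>Turning by \<open>g\<close> is free and a jump costs one, so \<open>lev\<close> is a
  distance between orbits. With \<open>rot\<close> and all darts it is the graph distance of
  vertices; with \<open>contour\<close> and the black darts it is the directed dual distance of
  faces.\<close>

locale levels =
  fixes g j :: "'a \<Rightarrow> 'a" and A D :: "'a set" and r :: 'a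
  assumes perm_g: "permutation g"
    and reachable: "x \<in> D \<Longrightarrow> \<exists>n. reach g j A r n x"
begin

abbreviation lev :: "'a \<Rightarrow> nat" where "lev \<equiv> level g j A r"

lemma orbit_sym: "y \<in> orbit g x \<longleftrightarrow> x \<in> orbit g y"
  using perm_g permutation_self_in_orbit orbit_swap by metis

lemma reach_orbit: "y \<in> orbit g x \<Longrightarrow> reach g j A r n x \<Longrightarrow> reach g j A r n y"
  by (induction rule: orbit.induct) (auto intro: reach.turn)

lemma reach_lev: "x \<in> D \<Longrightarrow> reach g j A r (lev x) x"
  unfolding level_def by (rule LeastI_ex) (rule reachable)

lemma lev_le: "reach g j A r n x \<Longrightarrow> lev x \<le> n"
  unfolding level_def by (rule Least_le)

lemma lev_start: "lev r = 0"
  using lev_le[OF reach.start] by simp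

lemma lev_orbit:
  assumes "x \<in> D" "y \<in> D" "y \<in> orbit g x"
  shows "lev y = lev x"
  using assms reach_lev lev_le reach_orbit orbit_sym by (metis antisym)

lemma lev_turn: "x \<in> D \<Longrightarrow> g x \<in> D \<Longrightarrow> lev (g x) = lev x"
  by (rule lev_orbit) (auto intro: orbit.base)

lemma lev_jump: "x \<in> D \<Longrightarrow> x \<in> A \<Longrightarrow> lev (j x) \<le> Suc (lev x)"
  using reach_lev lev_le reach.jump by metis

text \<open>Turns after the last jump stay within one orbit, so a path can be split at its last
  jump.\<close>

lemma reach_cases:
  "reach g j A r n y \<Longrightarrow> n = 0 \<and> y \<in> orbit g r \<or>
     (\<exists>m x. n = Suc m \<and> reach g j A r m x \<and> x \<in> A \<and> j x \<in> orbit g y)"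
proof (induction rule: reach.induct)
  case start
  then show ?case using permutation_self_in_orbit[OF perm_g] by auto
next
  case (turn n x)
  then show ?case
    using permutation_orbit_step[OF perm_g, of x] by (auto intro: orbit.step)
next
  case (jump n x)
  then show ?case using permutation_self_in_orbit[OF perm_g] by blast
qed

lemma lev_0: "x \<in> D \<Longrightarrow> lev x = 0 \<Longrightarrow> x \<in> orbit g r"
  using reach_lev[of x] reach_cases by fastforce

lemma lev_Suc:
  assumes "y \<in> D" "lev y = Suc k" "A \<subseteq> D" "\<And>x. x \<in> D \<Longrightarrow> j x \<in> D"
  obtains x where "x \<in> A" "lev x = k" "j x \<in> orbit g y"
proof -
  obtain x where x: "reach g j A r k x" "x \<in> A" "j x \<in> orbit g y"
    using reach_cases[OF reach_lev[OF assms(1)]] assms(2) by auto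
  have "lev (j x) = lev y" using lev_orbit assms x by blast
  then have "lev x = k" using lev_le[OF x(1)] lev_jump[of x] assms x by force
  then show thesis using that x by blast
qed

end

section \<open>Maps and plane trees\<close>

lemma orbit_eq_if_in_orbit: "permutation g \<Longrightarrow> y \<in> orbit g x \<Longrightarrow> orbit g y = orbit g x"
  using cyclic_on_orbit'[of g x] unfolding cyclic_on_alldef by auto

lemma involution_permutes:
  "(\<And>x. x \<notin> S \<Longrightarrow> p x = x) \<Longrightarrow> (\<And>x. p (p x) = x) \<Longrightarrow> p permutes S"
  unfolding permutes_def by metis

lemma card_edges:
  assumes "finite (darts M)" "opp M permutes darts M" "\<And>d. opp M (opp M d) = d"
  shows "2 * card (edges M) + card (half_edges M) = card (darts M)"
proof -
  have mem: "opp M d \<in> darts M \<longleftrightarrow> d \<in> darts M" for d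
    using assms(2) by (rule permutes_in_image)
  have U: "\<Union>(edges M) = darts M - half_edges M"
    using assms(3) mem by (auto simp: edges_def half_edges_def)
  have fE: "finite (edges M)"
    by (rule finite_subset[of _ "Pow (darts M)"]) (use assms(1) mem in \<open>auto simp: edges_def\<close>)
  have "2 * card (edges M) = card (\<Union>(edges M))"
    using fE
  proof (rule card_partition)
    show "finite (\<Union>(edges M))" unfolding U using assms(1) by simp
    show "card c = 2" if "c \<in> edges M" for c
      using that by (auto simp: edges_def card_2_iff)
    show "c1 \<inter> c2 = {}" if c: "c1 \<in> edges M" "c2 \<in> edges M" "c1 \<noteq> c2" for c1 c2
    proof -
      obtain d e where "c1 = {d, opp M d}" "c2 = {e, opp M e}"
        using c unfolding edges_def by blast
      then show ?thesis using c(3) assms(3)[of d] assms(3)[of e] by auto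
    qed
  qed
  moreover have "half_edges M \<subseteq> darts M" by (auto simp: half_edges_def)
  ultimately show ?thesis
    unfolding U using assms(1) card_Diff_subset[of "half_edges M" "darts M"] card_mono[of "darts M" "half_edges M"]
    by (simp add: finite_subset)
qed

lemma component_self: "d \<in> component M d"
  by (simp add: component_def)

lemma component_rot: "x \<in> component M d \<Longrightarrow> x \<in> darts M \<Longrightarrow> rot M x \<in> component M d"
  unfolding component_def by (auto intro: rtrancl_into_rtrancl)

lemma component_opp: "x \<in> component M d \<Longrightarrow> x \<in> darts M \<Longrightarrow> opp M x \<in> component M d"
  unfolding component_def by (auto intro: rtrancl_into_rtrancl)

lemma component_induct [consumes 1, case_names start rot opp]:
  assumes "x \<in> component M d" "P d"
    and "\<And>y. P y \<Longrightarrow> y \<in> darts M \<Longrightarrow> P (rot M y)"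
    and "\<And>y. P y \<Longrightarrow> y \<in> darts M \<Longrightarrow> P (opp M y)"
  shows "P x"
  using assms(1) unfolding component_def mem_Collect_eq
  by (induction rule: rtrancl_induct) (use assms in auto)

lemma component_subset:
  assumes "rot M permutes darts M" "opp M permutes darts M" "d \<in> darts M"
  shows "component M d \<subseteq> darts M"
proof
  fix x assume "x \<in> component M d"
  then show "x \<in> darts M"
    by (induction rule: component_induct) (use assms in \<open>auto simp: permutes_in_image\<close>)
qed

text \<open>Each step of \<open>g\<close> stays within a component. For a closure, \<open>g\<close>
  will be the contour of the tree, which does not cross the fused edges.\<close>

lemma connected_map_if_cyclic:
  assumes "rot M permutes darts M" "opp M permutes darts M"
    and "\<And>x. x \<in> darts M \<Longrightarrow> g x = rot M x \<or> g x = rot M (opp M x)"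
    and "\<And>d. d \<in> darts M \<Longrightarrow> orbit g d = darts M"
  shows "connected_map M"
  unfolding connected_map_def
proof
  fix d assume d: "d \<in> darts M"
  have sub: "component M d \<subseteq> darts M" using assms d by (intro component_subset)
  have step: "g x \<in> component M d" if "x \<in> component M d" for x
    using that sub assms(3)[of x] component_rot[of _ M d] component_opp[of _ M d]
    by (metis assms(2) permutes_in_image subsetD)
  have "x \<in> component M d" if "x \<in> orbit g d" for x
    using that by induction (auto intro: step component_self)
  then show "component M d = darts M" using sub assms(4)[OF d] by auto
qed

text \<open>Every vertex other than that of \<open>r\<close> has an edge towards a vertex closer to
  \<open>r\<close>, and such an edge determines its farther end.\<close>

lemma card_vertices_le_edges:
  assumes fin: "finite (darts M)" and rot: "rot M permutes darts M"
    and opp: "opp M permutes darts M" "\<And>d. opp M (opp M d) = d"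
    and r: "r \<in> darts M" and conn: "component M r = darts M"
  shows "card (vertices M) \<le> Suc (card (edges M))"
proof -
  have perm: "permutation (rot M)" using fin rot by (auto simp: permutation_permutes)
  have opp_in: "opp M d \<in> darts M \<longleftrightarrow> d \<in> darts M" for d
    using opp(1) by (rule permutes_in_image)
  \<comment> \<open>All darts may jump here, so \<open>lev\<close> is the graph distance of a vertex
    from that of \<open>r\<close>.\<close>
  interpret levels "rot M" "opp M" "darts M" "darts M" r
  proof
    fix x assume "x \<in> darts M"
    then have "x \<in> component M r" using conn by simp
    then show "\<exists>n. reach (rot M) (opp M) (darts M) r n x"
      by (induction rule: component_induct) (auto intro: reach.intros)
  qed (rule perm)
  let ?v0 = "orbit (rot M) r"
  have orb: "orbit (rot M) y = orbit (rot M) x" if "y \<in> orbit (rot M) x" for x y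
    using cyclic_on_orbit'[OF perm, of x] that unfolding cyclic_on_alldef by auto
  have "\<exists>z. z \<in> v \<and> z \<in> darts M \<and> lev z = Suc (lev (opp M z))"
    if v: "v \<in> vertices M - {?v0}" for v
  proof -
    obtain y where y: "y \<in> darts M" "v = orbit (rot M) y" using v by (auto simp: vertices_def)
    have "lev y \<noteq> 0" using lev_0[OF y(1)] orb v y by auto
    then obtain k where k: "lev y = Suc k" using not0_implies_Suc by auto
    obtain x where x: "x \<in> darts M" "lev x = k" "opp M x \<in> orbit (rot M) y"
      by (rule lev_Suc[OF y(1) k]) (auto simp: opp_in)
    have "lev (opp M x) = Suc k" using lev_orbit[OF y(1) _ x(3)] x k opp_in by auto
    then show ?thesis using x y opp by (intro exI[of _ "opp M x"]) (auto simp: opp_in)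
  qed
  then obtain Z where Z: "\<And>v. v \<in> vertices M - {?v0} \<Longrightarrow>
      Z v \<in> v \<and> Z v \<in> darts M \<and> lev (Z v) = Suc (lev (opp M (Z v)))"
    by metis
  let ?e = "\<lambda>v. {Z v, opp M (Z v)}"
  have fE: "finite (edges M)"
    by (rule finite_subset[of _ "Pow (darts M)"]) (use fin opp_in in \<open>auto simp: edges_def\<close>)
  have "inj_on ?e (vertices M - {?v0})"
  proof (rule inj_onI)
    fix v w assume vw: "v \<in> vertices M - {?v0}" "w \<in> vertices M - {?v0}" "?e v = ?e w"
    have "Z v = Z w"
    proof (rule ccontr)
      assume "Z v \<noteq> Z w"
      then have "Z v = opp M (Z w)" "opp M (Z v) = Z w" using vw(3) by (auto simp: doubleton_eq_iff)
      then show False using Z[OF vw(1)] Z[OF vw(2)] by auto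
    qed
    moreover have "v = orbit (rot M) (Z v)" "w = orbit (rot M) (Z w)"
      using orb Z[OF vw(1)] Z[OF vw(2)] vw by (auto simp: vertices_def)
    ultimately show "v = w" by simp
  qed
  moreover have "?e ` (vertices M - {?v0}) \<subseteq> edges M"
  proof
    fix e assume "e \<in> ?e ` (vertices M - {?v0})"
    then obtain v where v: "v \<in> vertices M - {?v0}" "e = ?e v" by blast
    have "opp M (Z v) \<noteq> Z v" using Z[OF v(1)] by (metis n_not_Suc_n)
    then show "e \<in> edges M" using v Z[OF v(1)] unfolding edges_def by blast
  qed
  ultimately have "card (vertices M - {?v0}) \<le> card (edges M)"
    using fE by (rule card_inj_on_le)
  moreover have "card (vertices M) \<le> Suc (card (vertices M - {?v0}))"
    using fin by (simp add: vertices_def card_Diff_singleton_if) linarith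
  ultimately show ?thesis by simp
qed

locale bip_map =
  fixes M :: bmap
  assumes bip: "bipartite_map M"
begin

lemma fin: "finite (darts M)" and rot_perm: "rot M permutes darts M"
  and opp_perm: "opp M permutes darts M" and opp_opp [simp]: "opp M (opp M d) = d"
  and white_sub: "white M \<subseteq> darts M"
  and rot_white: "d \<in> darts M \<Longrightarrow> rot M d \<in> white M \<longleftrightarrow> d \<in> white M"
  and opp_white: "d \<in> darts M \<Longrightarrow> opp M d \<noteq> d \<Longrightarrow> opp M d \<in> white M \<longleftrightarrow> d \<notin> white M"
  and conn: "connected_map M"
  and euler: "card (vertices M) + card (faces M) = card (edges M) + 2"
  and root_half: "root_dart M \<in> half_edges M"
  and half_outer: "half_edges M \<subseteq> orbit (contour M) (root_dart M)"
  using bip unfolding bipartite_map_def by auto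

lemma rot_in [simp]: "rot M d \<in> darts M \<longleftrightarrow> d \<in> darts M"
  using rot_perm by (rule permutes_in_image)

lemma opp_in [simp]: "opp M d \<in> darts M \<longleftrightarrow> d \<in> darts M"
  using opp_perm by (rule permutes_in_image)

lemma opp_inj: "opp M x = opp M y \<longleftrightarrow> x = y"
  by (metis opp_opp)

lemma contour_perm: "contour M permutes darts M"
  unfolding contour_def using opp_perm rot_perm by (rule permutes_compose)

lemma contour_in [simp]: "contour M d \<in> darts M \<longleftrightarrow> d \<in> darts M"
  using contour_perm by (rule permutes_in_image)

lemma contour_permutation: "permutation (contour M)"
  using fin contour_perm by (auto simp: permutation_permutes)

lemma contour_inj [simp]: "contour M x = contour M y \<longleftrightarrow> x = y"
  using permutes_inj[OF contour_perm] by (auto dest: injD)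

lemma self_orbit: "x \<in> orbit (contour M) x"
  using contour_permutation by (rule permutation_self_in_orbit)

lemma orbit_in: "y \<in> orbit (contour M) x \<Longrightarrow> x \<in> darts M \<Longrightarrow> y \<in> darts M"
  using permutes_orbit_subset[OF contour_perm] by blast

lemma orbit_eqI: "y \<in> orbit (contour M) x \<Longrightarrow> orbit (contour M) y = orbit (contour M) x"
  using contour_permutation by (rule orbit_eq_if_in_orbit)

lemma orbit_sym: "y \<in> orbit (contour M) x \<longleftrightarrow> x \<in> orbit (contour M) y"
  using orbit_eqI self_orbit by blast

lemma half_sub: "half_edges M \<subseteq> darts M" by (auto simp: half_edges_def)

lemma root_in: "root_dart M \<in> darts M" using root_half half_sub by blast

lemma fin_half: "finite (half_edges M)" using half_sub fin by (rule finite_subset)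

lemma leaves_un_buds: "leaves M \<union> buds M = half_edges M" "leaves M \<inter> buds M = {}"
  by (auto simp: leaves_def buds_def)

lemma fin_leaves [simp]: "finite (leaves M)" and fin_buds [simp]: "finite (buds M)"
  using fin_half by (auto simp: leaves_def buds_def)

lemma fin_vertices: "finite (vertices M)" and fin_faces: "finite (faces M)"
  using fin by (auto simp: vertices_def faces_def)

end

locale tree_map = bip_map T for T +
  assumes tree: "plane_tree T"
begin

lemma contour_orbit: "x \<in> darts T \<Longrightarrow> orbit (contour T) x = darts T"
proof -
  assume x: "x \<in> darts T"
  obtain F where F: "faces T = {F}" using tree by (auto simp: plane_tree_def card_1_singleton_iff)
  have eq: "orbit (contour T) y = orbit (contour T) x" if "y \<in> darts T" for y
    using F that x unfolding faces_def by blast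
  show ?thesis
  proof
    show "orbit (contour T) x \<subseteq> darts T" using orbit_in x by blast
    show "darts T \<subseteq> orbit (contour T) x" using eq self_orbit by blast
  qed
qed

lemma cyclic_walk: "q \<in> darts T \<Longrightarrow> cyclic_walk (contour T) (darts T) q"
  by unfold_locales (use fin contour_perm contour_orbit in auto)

end

section \<open>Cutting an edge of a plane tree\<close>

locale based_tree = tree_map T for T +
  fixes q
  assumes q_in: "q \<in> darts T"
begin

sublocale cyclic_walk "contour T" "darts T" q
  using q_in by (rule cyclic_walk)

text \<open>The cut exchanges the contour successors of \<open>x\<close> and \<open>y\<close>, which
  splits the cyclic walk into the stretch after \<open>x\<close> up to \<open>y\<close> and the
  rest. Each of the two cycles lies in one component, and counting edges shows that the cut tree is
  not connected, so the components are exactly the cycles.\<close>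

lemma component_cut:
  assumes x: "x \<in> darts T" and y: "opp T x = y" and lt: "pos x < pos y"
  shows "component (cut T x) x = {z \<in> darts T. \<not> (pos x < pos z \<and> pos z \<le> pos y)}"
    and "component (cut T y) y = {z \<in> darts T. pos x < pos z \<and> pos z \<le> pos y}"
proof -
  define N where "N = cut T x"
  have yx: "opp T y = x" using y by auto
  have yD: "y \<in> darts T" using x y by auto
  have xy: "x \<noteq> y" using lt by auto
  have Ny: "cut T y = N" unfolding N_def cut_def yx y using xy by (simp add: fun_upd_twist)
  have N: "darts N = darts T" "rot N = rot T"
    and oN: "opp N z = (if z \<in> {x, y} then z else opp T z)" for z
    using y by (auto simp: N_def cut_def)
  have oNN: "opp N (opp N z) = z" for z using y yx opp_inj by (auto simp: oN)
  have oNperm: "opp N permutes darts N"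
    using opp_perm x yD oNN by (intro involution_permutes) (auto simp: oN N permutes_not_in)
  have rNperm: "rot N permutes darts N" using rot_perm N by simp
  let ?g = "contour N"
  have gperm: "permutation ?g"
    using permutes_compose[OF oNperm rNperm] fin N unfolding contour_def
    by (auto simp: permutation_permutes)
  have g: "?g x = contour T y" "?g y = contour T x" "z \<notin> {x, y} \<Longrightarrow> ?g z = contour T z" for z
    using y yx by (auto simp: contour_def oN N)
  let ?I = "{z \<in> darts T. pos x < pos z \<and> pos z \<le> pos y}"
  have I: "z \<in> orbit ?g y" if "z \<in> darts T" "pos x < pos z" "pos z \<le> pos y" for z
    using that
  proof (induction "pos z" arbitrary: z)
    case (Suc n)
    obtain w where w: "w \<in> darts T" "contour T w = z" using pred_ex Suc.prems by blast
    have "z \<noteq> q" using Suc by auto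
    then have pw: "pos w = n" using pos_step[of w] w Suc(2) by auto
    show ?case
    proof (cases "w = x")
      case True
      then show ?thesis using g(2) w orbit.base by metis
    next
      case False
      then have "pos w \<noteq> pos x" using pos_inj w x by auto
      then have "w \<in> orbit ?g y" using Suc pw w by auto
      moreover have "w \<noteq> y" using pw Suc by auto
      ultimately show ?thesis using g(3)[of w] False w orbit.step by (metis empty_iff insertE)
    qed
  qed simp
  have O1: "z \<in> orbit ?g x" if "z \<in> darts T" "pos y < pos z" for z
    using that
  proof (induction "pos z" arbitrary: z)
    case (Suc n)
    obtain w where w: "w \<in> darts T" "contour T w = z" using pred_ex Suc.prems by blast
    have "z \<noteq> q" using Suc by auto
    then have pw: "pos w = n" using pos_step[of w] w Suc(2) by auto
    show ?case
    proof (cases "w = y")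
      case True
      then show ?thesis using g(1) w orbit.base by metis
    next
      case False
      then have "pos w \<noteq> pos y" using pos_inj w yD by auto
      then have "w \<in> orbit ?g x" using Suc pw w by auto
      moreover have "w \<noteq> x" using pw Suc lt by auto
      ultimately show ?thesis using g(3)[of w] False w orbit.step by (metis empty_iff insertE)
    qed
  qed simp
  have O2: "z \<in> orbit ?g x" if "z \<in> darts T" "pos z \<le> pos x" for z
    using that
  proof (induction "pos z" arbitrary: z)
    case 0
    obtain w where w: "w \<in> darts T" "contour T w = z" using pred_ex 0 by blast
    \<comment> \<open>The predecessor of the base point is the last dart of the walk, so it is
      \<open>y\<close> itself or covered by \<open>O1\<close>.\<close>
    have zq: "z = q" using pos_eq_0 0 by auto
    then have pw: "pos y \<le> pos w" using pos_last w yD by auto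
    show ?case
    proof (cases "w = y")
      case True
      then show ?thesis using g(1) w orbit.base by metis
    next
      case False
      then have "pos w \<noteq> pos y" using pos_inj w yD by auto
      then have "w \<in> orbit ?g x" using O1 pw w by auto
      moreover have "w \<noteq> x" using pw lt by auto
      ultimately show ?thesis using g(3)[of w] False w orbit.step by (metis empty_iff insertE)
    qed
  next
    case (Suc n)
    obtain w where w: "w \<in> darts T" "contour T w = z" using pred_ex Suc.prems by blast
    have "z \<noteq> q" using Suc by auto
    then have pw: "pos w = n" using pos_step[of w] w Suc(2) by auto
    have "w \<in> orbit ?g x" using Suc pw w by auto
    moreover have "w \<noteq> x" "w \<noteq> y" using pw Suc lt by auto
    ultimately show ?case using g(3)[of w] w orbit.step by (metis empty_iff insertE)
  qed
  have O: "darts T - ?I \<subseteq> orbit ?g x" using O1 O2 by force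
  have sub: "component N d \<subseteq> darts T" if "d \<in> darts T" for d
    using component_subset[OF rNperm oNperm] N that by simp
  have gstep: "?g z \<in> component N d" if "z \<in> component N d" "d \<in> darts T" for z d
    using that sub[OF that(2)] component_opp[of z N d] component_rot[of _ N d] N oNperm
    unfolding contour_def by (metis comp_apply permutes_in_image subsetD)
  have gorb: "orbit ?g z \<subseteq> component N d" if "z \<in> component N d" "d \<in> darts T" for z d
  proof
    fix u assume "u \<in> orbit ?g z"
    then show "u \<in> component N d" by induction (use gstep that in auto)
  qed
  have sym: "u \<in> orbit ?g v \<Longrightarrow> v \<in> orbit ?g u" for u v
    using gperm permutation_self_in_orbit orbit_swap by metis
  \<comment> \<open>The cut keeps the vertices and loses an edge, which leaves two more vertices
    than edges; a connected map has at most one more.\<close>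
  have nc: "component N d \<noteq> darts T" if "d \<in> darts T" for d
  proof
    assume "component N d = darts T"
    then have "card (vertices N) \<le> Suc (card (edges N))"
      using N fin rNperm oNperm oNN that by (intro card_vertices_le_edges[of N d]) auto
    moreover have "vertices N = vertices T" by (simp add: vertices_def N)
    moreover have "half_edges N = insert x (insert y (half_edges T))"
      using x yD by (auto simp: half_edges_def N oN)
    then have "card (half_edges N) = Suc (Suc (card (half_edges T)))"
      using xy y yx fin_half by (auto simp: half_edges_def)
    moreover have "2 * card (edges N) + card (half_edges N) = card (darts T)"
      using card_edges[of N] N fin oNperm oNN by simp
    moreover have "2 * card (edges T) + card (half_edges T) = card (darts T)"
      using card_edges[of T] fin opp_perm by simp
    moreover have "card (vertices T) + 1 = card (edges T) + 2"
      using euler tree by (simp add: plane_tree_def)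
    ultimately show False by simp
  qed
  have "component N y = ?I"
  proof (rule ccontr)
    assume ne: "component N y \<noteq> ?I"
    have Isub: "?I \<subseteq> component N y"
      using I gorb[OF component_self yD] by blast
    then obtain z where z: "z \<in> component N y" "z \<in> darts T - ?I"
      using ne sub[OF yD] by blast
    then have "z \<in> orbit ?g x" using O by blast
    then have "x \<in> component N y" using gorb[OF z(1) yD] sym by blast
    then have "darts T - ?I \<subseteq> component N y" using O gorb[OF _ yD] by blast
    then show False using Isub nc[OF yD] sub[OF yD] by blast
  qed
  then show "component (cut T y) y = ?I" by (simp add: Ny)
  have "component N x = darts T - ?I"
  proof (rule ccontr)
    assume ne: "component N x \<noteq> darts T - ?I"
    have Osub: "darts T - ?I \<subseteq> component N x"
      using O gorb[OF component_self x] by blast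
    then obtain z where z: "z \<in> component N x" "z \<in> ?I"
      using ne sub[OF x] by blast
    then have "z \<in> orbit ?g y" using I by blast
    then have "y \<in> component N x" using gorb[OF z(1) x] sym by blast
    then have "?I \<subseteq> component N x" using I gorb[OF _ x] by blast
    then show False using Osub nc[OF x] sub[OF x] by blast
  qed
  then show "component (cut T x) x = {z \<in> darts T. \<not> (pos x < pos z \<and> pos z \<le> pos y)}"
    by (auto simp: N_def)
qed

end

section \<open>Matching of buds and leaves\<close>

lemma matchedD:
  assumes "matched T b l"
  shows "b \<in> buds T" "l \<in> leaves T"
    "h \<in> between T b l \<Longrightarrow> \<exists>h'\<in>between T b l. matched T h h' \<or> matched T h' h"
  using assms by (auto elim: matched.cases)

lemma bud_leaf_distinct: "b \<in> buds T \<Longrightarrow> l \<in> leaves T \<Longrightarrow> b \<noteq> l"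
  by (auto simp: buds_def leaves_def)

locale single_tree = tree_map T for T +
  fixes q
  assumes single: "q \<in> single_leaves T"
begin

lemma q_leaf: "q \<in> leaves T" and q_unmatched: "\<not> matched T b q" "\<not> matched T q l"
  using single matchedD(1)[of T q l] bud_leaf_distinct by (auto simp: single_leaves_def)

sublocale based_tree T q
  by unfold_locales (use q_leaf in \<open>auto simp: leaves_def half_edges_def\<close>)

lemma bud_in: "b \<in> buds T \<Longrightarrow> b \<in> darts T" and leaf_in: "l \<in> leaves T \<Longrightarrow> l \<in> darts T"
  by (auto simp: buds_def leaves_def half_edges_def)

lemma matched_in: "matched T b l \<Longrightarrow> b \<in> darts T \<and> l \<in> darts T"
  using matchedD bud_in leaf_in by blast

lemma between_forward:
  "b \<in> darts T \<Longrightarrow> l \<in> darts T \<Longrightarrow> pos b < pos l \<Longrightarrow>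
     between T b l = {h \<in> half_edges T. pos b < pos h \<and> pos h < pos l}"
  unfolding between_def by (subst strictly_between_forward) (auto simp: half_edges_def)

lemma between_wrap:
  "b \<in> darts T \<Longrightarrow> l \<in> darts T \<Longrightarrow> pos l \<le> pos b \<Longrightarrow>
     between T b l = {h \<in> half_edges T. pos b < pos h \<or> pos h < pos l}"
  unfolding between_def by (subst strictly_between_wrap) (auto simp: half_edges_def)

text \<open>A pair wrapping around the base point would have the unmatched leaf \<open>q\<close>
  strictly inside, where every half-edge has a partner. Thus the cyclic bracket matching becomes a
  linear one.\<close>

lemma matched_pos:
  assumes "matched T b l"
  shows "pos b < pos l"
proof (rule ccontr)
  assume "\<not> pos b < pos l"
  moreover have "l \<noteq> q" using q_unmatched assms by blast
  ultimately have "q \<in> between T b l"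
    using matched_in[OF assms] q_leaf pos_eq_0[of l]
    by (auto simp: between_wrap leaves_def)
  then show False using matchedD(3)[OF assms] q_unmatched by blast
qed

lemma between_matched:
  "matched T b l \<Longrightarrow> between T b l = {h \<in> half_edges T. pos b < pos h \<and> pos h < pos l}"
  using matched_pos matched_in between_forward by blast

lemma matched_half: "matched T b l \<Longrightarrow> b \<in> half_edges T \<and> l \<in> half_edges T"
  using matchedD(1,2) by (auto simp: buds_def leaves_def)

text \<open>Infinite descent: \<open>l\<close> lies inside the pair \<open>b\<close>,
  \<open>l'\<close> and has a partner \<open>b'\<close> there; \<open>b'\<close> lies inside the
  pair \<open>b\<close>, \<open>l\<close> and has a partner \<open>l2\<close> there. So
  \<open>b'\<close> has two partners as well, within a shorter range.\<close>

lemma matched_less_False: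
  "matched T b l \<Longrightarrow> matched T b l' \<Longrightarrow> pos l < pos l' \<Longrightarrow> False"
proof (induction "pos l' - pos b" arbitrary: b l l' rule: less_induct)
  case less
  have "l \<in> between T b l'"
    using between_matched[OF less.prems(2)] matched_pos[OF less.prems(1)]
      matched_half[OF less.prems(1)] less.prems by auto
  then obtain b' where b': "b' \<in> between T b l'" "matched T b' l"
    using matchedD[OF less.prems(2)] matchedD(1)[of T l] matchedD(2)[OF less.prems(1)] bud_leaf_distinct
    by metis
  have "pos b < pos b'" "pos b' < pos l"
    using b' between_matched[OF less.prems(2)] matched_pos[OF b'(2)] by auto
  then have "b' \<in> between T b l"
    using between_matched[OF less.prems(1)] matched_half[OF b'(2)] by auto
  then obtain l2 where l2: "l2 \<in> between T b l" "matched T b' l2"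
    using matchedD(3)[OF less.prems(1)] matchedD(2)[of T _ b'] matchedD(1)[OF b'(2)] bud_leaf_distinct
    by metis
  have "pos l2 < pos l" using l2 between_matched[OF less.prems(1)] by auto
  then show False
    using less.hyps[OF _ l2(2) b'(2)] less.prems
      \<open>pos b < pos b'\<close> \<open>pos b' < pos l\<close> by linarith
qed

lemma matched_fun: "matched T b l \<Longrightarrow> matched T b l' \<Longrightarrow> l = l'"
  using matched_less_False[of b l l'] matched_less_False[of b l' l] pos_inj[of l l'] matched_in
  by (metis linorder_neqE_nat)

text \<open>Of two buds with the same leaf, the later one lies inside the pair of the earlier one
  and would have a second partner strictly before \<open>l\<close>.\<close>

lemma matched_inj:
  assumes "matched T b l" "matched T b' l"
  shows "b = b'"
proof (rule ccontr)
  have *: False if "matched T b l" "matched T b' l" "pos b < pos b'" for b b'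
  proof -
    note m = that
    have "b' \<in> between T b l"
      using m between_matched[OF m(1)] matched_half[OF m(2)] matched_pos by auto
    then obtain l2 where "l2 \<in> between T b l" "matched T b' l2"
      using matchedD(3)[OF m(1)] matchedD(2)[of T _ b'] matchedD(1)[OF m(2)] bud_leaf_distinct
      by metis
    then show False using matched_fun[OF m(2)] between_matched[OF m(1)] by auto
  qed
  assume "b \<noteq> b'"
  then have "pos b < pos b' \<or> pos b' < pos b"
    using pos_inj[of b b'] matched_in assms by (metis linorder_neqE_nat)
  then show False using * assms by blast
qed

lemma matched_nest:
  assumes "matched T b l" "matched T b' l'" "pos b < pos b'" "pos b' < pos l"
  shows "pos l' < pos l"
proof -
  have "b' \<in> between T b l"
    using assms between_matched[OF assms(1)] matched_half[OF assms(2)] by auto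
  then obtain l2 where "l2 \<in> between T b l" "matched T b' l2"
    using matchedD(3)[OF assms(1)] matchedD(2)[of T _ b'] matchedD(1)[OF assms(2)] bud_leaf_distinct
    by metis
  then show ?thesis using matched_fun[OF assms(2)] between_matched[OF assms(1)] by auto
qed

text \<open>Otherwise the last unmatched bud could be matched with the first unmatched leaf after it,
  or with \<open>q\<close> if there is none.\<close>
lemma bud_matched:
  assumes "b \<in> buds T"
  shows "\<exists>l. matched T b l"
proof (rule ccontr)
  assume un: "\<not> ?thesis"
  define U where "U = {b \<in> buds T. \<nexists>l. matched T b l}"
  have U: "finite U" "U \<noteq> {}" using assms un by (auto simp: U_def)
  then have "Max (pos ` U) \<in> pos ` U" by (intro Max_in) auto
  then obtain b0 where b0: "b0 \<in> U" "pos b0 = Max (pos ` U)" by auto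
  have b0max: "pos b \<le> pos b0" if "b \<in> U" for b
    using that U b0 by simp
  have b0b: "b0 \<in> buds T" "b0 \<in> darts T" "b0 \<in> half_edges T" and b0u: "\<not> matched T b0 l" for l
    using b0 bud_in by (auto simp: U_def buds_def)
  define V where "V = {l \<in> leaves T. (\<nexists>b. matched T b l) \<and> pos b0 < pos l}"
  have paired: "\<exists>h'. matched T h h' \<or> matched T h' h"
    if "h \<in> half_edges T" "pos b0 < pos h" "h \<notin> V" for h
  proof (cases "h \<in> buds T")
    case True
    then show ?thesis using b0max[of h] that by (auto simp: U_def)
  next
    case False
    then show ?thesis using that by (auto simp: V_def buds_def leaves_def)
  qed
  \<comment> \<open>A pair straddling \<open>b0\<close> would have \<open>b0\<close> inside and
    hence matched, so every pair lies on one side of it.\<close>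
  have right: "pos b0 < pos h \<longleftrightarrow> pos b0 < pos h'"
    if "matched T h h'" for h h'
  proof -
    have "pos b0 < pos h" if "pos b0 < pos h'"
    proof (rule ccontr)
      assume "\<not> pos b0 < pos h"
      moreover have "h \<noteq> b0" using b0u \<open>matched T h h'\<close> by blast
      ultimately have "pos h < pos b0"
        using pos_inj[of h b0] b0b matched_in[OF \<open>matched T h h'\<close>] by auto
      then have "b0 \<in> between T h h'"
        using between_matched[OF \<open>matched T h h'\<close>] b0b that by auto
      then show False
        using matchedD(3)[OF \<open>matched T h h'\<close>] b0u matchedD(2) b0b(1) bud_leaf_distinct by metis
    qed
    then show ?thesis using matched_pos[OF that] by auto
  qed
  show False
  proof (cases "V = {}")
    case True
    have btw: "between T b0 q = {h \<in> half_edges T. pos b0 < pos h}"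
      using b0b q_in by (subst between_wrap) auto
    have "\<exists>h'\<in>between T b0 q. matched T h h' \<or> matched T h' h" if "h \<in> between T b0 q" for h
      using paired[of h] right that True matched_half unfolding btw by blast
    then have "matched T b0 q" using b0b q_leaf by (intro matched.intros) auto
    then show False using b0u by blast
  next
    case False
    have "finite V" by (auto simp: V_def)
    with False have "Min (pos ` V) \<in> pos ` V" by (intro Min_in) auto
    then obtain l0 where l0: "l0 \<in> V" "pos l0 = Min (pos ` V)" by auto
    have l0min: "pos l0 \<le> pos l" if "l \<in> V" for l
      using that \<open>finite V\<close> l0 by simp
    have l0l: "l0 \<in> leaves T" "l0 \<in> darts T" "l0 \<in> half_edges T" "pos b0 < pos l0"
      and l0u: "\<not> matched T b l0" for b
      using l0 leaf_in by (auto simp: V_def leaves_def)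
    have btw: "between T b0 l0 = {h \<in> half_edges T. pos b0 < pos h \<and> pos h < pos l0}"
      using b0b l0l by (intro between_forward) auto
    have left: "pos h < pos l0 \<longleftrightarrow> pos h' < pos l0" if "matched T h h'" for h h'
    proof -
      have "pos h' < pos l0" if "pos h < pos l0"
      proof (rule ccontr)
        assume "\<not> pos h' < pos l0"
        moreover have "h' \<noteq> l0" using l0u \<open>matched T h h'\<close> by blast
        ultimately have "pos l0 < pos h'"
          using pos_inj[of h' l0] l0l matched_in[OF \<open>matched T h h'\<close>] by auto
        then have "l0 \<in> between T h h'"
          using between_matched[OF \<open>matched T h h'\<close>] l0l that by auto
        then show False
          using matchedD(3)[OF \<open>matched T h h'\<close>] l0u matchedD(1) l0l(1) bud_leaf_distinct by metis
      qed
      then show ?thesis using matched_pos[OF that] by auto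
    qed
    have "\<exists>h'\<in>between T b0 l0. matched T h h' \<or> matched T h' h" if h: "h \<in> between T b0 l0" for h
    proof -
      have "h \<notin> V" using l0min[of h] h unfolding btw by auto
      then obtain h' where "matched T h h' \<or> matched T h' h"
        using paired[of h] h unfolding btw by auto
      then show ?thesis using right left matched_half h unfolding btw by blast
    qed
    then have "matched T b0 l0" using b0b l0l by (intro matched.intros) auto
    then show False using b0u by blast
  qed
qed

definition mate :: "nat \<Rightarrow> nat" where
  "mate b = (SOME l. matched T b l)"

lemma matched_mate: "b \<in> buds T \<Longrightarrow> matched T b (mate b)"
  unfolding mate_def by (rule someI_ex) (rule bud_matched)

lemma matched_iff: "matched T b l \<longleftrightarrow> b \<in> buds T \<and> l = mate b"
  using matched_mate matched_fun matchedD(1) by blast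

lemma mate_inj: "inj_on mate (buds T)"
  by (metis inj_onI matched_inj matched_mate)

lemma mate_image: "mate ` buds T = leaves T - single_leaves T"
  using matched_mate matchedD by (auto simp: single_leaves_def matched_iff)

lemma card_single_leaves: "int (card (single_leaves T)) = total_charge T"
proof -
  have sub: "single_leaves T \<subseteq> leaves T" by (auto simp: single_leaves_def)
  have "card (buds T) = card (leaves T - single_leaves T)"
    using card_image[OF mate_inj] mate_image by simp
  also have "\<dots> = card (leaves T) - card (single_leaves T)"
    using sub by (intro card_Diff_subset) (auto intro: finite_subset)
  finally show ?thesis
    using card_mono[OF _ sub] by (simp add: total_charge_def)
qed

end

section \<open>The closure of a balanced tree\<close>

text \<open>The condition is symmetric because \<open>opp\<close> must exchange the two ends of a
  pair. Once partners are known to be unique, \<open>SOME\<close> has a single candidate.\<close>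

definition tree_closure :: "bmap \<Rightarrow> bmap" where
  "tree_closure T = T\<lparr>opp := \<lambda>x. if \<exists>y. matched T x y \<or> matched T y x
     then SOME y. matched T x y \<or> matched T y x else opp T x\<rparr>"

lemma tree_closure_simps [simp]:
  "darts (tree_closure T) = darts T" "rot (tree_closure T) = rot T"
  "white (tree_closure T) = white T" "root_dart (tree_closure T) = root_dart T"
  by (simp_all add: tree_closure_def)

locale charge2_tree = tree_map T for T +
  fixes s
  assumes singles: "single_leaves T = {root_dart T, s}" and s_root: "s \<noteq> root_dart T"
begin

sublocale single_tree T s
  by unfold_locales (simp add: singles)

abbreviation r where "r \<equiv> root_dart T"

lemma r_leaf: "r \<in> leaves T" and r_unmatched: "\<not> matched T b r"
  using singles by (auto simp: single_leaves_def)

lemma mate_image': "mate ` buds T = leaves T - {r, s}"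
  using mate_image singles by simp

lemma mate_leaf: "b \<in> buds T \<Longrightarrow> mate b \<in> leaves T"
  using mate_image' by blast

lemma mate_in: "b \<in> buds T \<Longrightarrow> mate b \<in> darts T"
  using mate_leaf leaf_in by blast

lemma pos_mate: "b \<in> buds T \<Longrightarrow> pos b < pos (mate b)"
  using matched_pos matched_mate by blast

lemma half_edges_eq: "half_edges T = insert r (insert s (buds T \<union> mate ` buds T))"
  using mate_image' leaves_un_buds r_leaf q_leaf by auto

lemma opp_bud: "b \<in> buds T \<Longrightarrow> opp T b = b" and opp_leaf: "l \<in> leaves T \<Longrightarrow> opp T l = l"
  by (auto simp: buds_def leaves_def half_edges_def)

lemma opp_closure_bud: "b \<in> buds T \<Longrightarrow> opp (tree_closure T) b = mate b"
  and opp_closure_mate: "b \<in> buds T \<Longrightarrow> opp (tree_closure T) (mate b) = b"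
proof -
  assume b: "b \<in> buds T"
  have "matched T b y \<or> matched T y b \<longleftrightarrow> y = mate b" for y
    using b mate_leaf bud_leaf_distinct by (auto simp: matched_iff)
  then show "opp (tree_closure T) b = mate b" by (simp add: tree_closure_def)
  have "matched T (mate b) y \<or> matched T y (mate b) \<longleftrightarrow> y = b" for y
    using b mate_leaf bud_leaf_distinct mate_inj by (auto simp: matched_iff dest: inj_onD)
  then show "opp (tree_closure T) (mate b) = b" by (simp add: tree_closure_def)
qed

lemma opp_closure_other:
  "x \<notin> buds T \<Longrightarrow> x \<notin> mate ` buds T \<Longrightarrow> opp (tree_closure T) x = opp T x"
  by (auto simp: tree_closure_def matched_iff)

lemma dart_cases:
  obtains (bud) "x \<in> buds T" | (mate) b where "b \<in> buds T" "x = mate b"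
  | (other) "x \<notin> buds T" "x \<notin> mate ` buds T"
  by blast

lemma contour_closure_bud: "b \<in> buds T \<Longrightarrow> contour (tree_closure T) b = contour T (mate b)"
  and contour_closure_mate: "b \<in> buds T \<Longrightarrow> contour (tree_closure T) (mate b) = contour T b"
  and contour_closure_other:
    "x \<notin> buds T \<Longrightarrow> x \<notin> mate ` buds T \<Longrightarrow> contour (tree_closure T) x = contour T x"
  using opp_leaf[OF mate_leaf]
  by (simp_all add: contour_def opp_closure_bud opp_closure_mate opp_closure_other opp_bud)

lemma opp_opp_closure: "opp (tree_closure T) (opp (tree_closure T) x) = x"
proof (cases x rule: dart_cases)
  case other
  then have "opp T x \<notin> buds T" "opp T x \<notin> mate ` buds T"
    using opp_bud opp_leaf[OF mate_leaf] opp_opp by (metis, metis imageE)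
  then show ?thesis using other by (simp add: opp_closure_other)
qed (auto simp: opp_closure_bud opp_closure_mate)

lemma opp_closure_perm: "opp (tree_closure T) permutes darts T"
proof (rule involution_permutes)
  fix x assume x: "x \<notin> darts T"
  then have "x \<notin> buds T" "x \<notin> mate ` buds T" using bud_in mate_in by blast+
  then show "opp (tree_closure T) x = x"
    using opp_closure_other permutes_not_in[OF opp_perm x] by simp
qed (rule opp_opp_closure)

lemma half_edges_closure: "half_edges (tree_closure T) = {r, s}"
proof -
  have rs: "r \<notin> buds T \<union> mate ` buds T" "s \<notin> buds T \<union> mate ` buds T"
    using mate_image' r_leaf q_leaf bud_leaf_distinct by blast+
  have "opp (tree_closure T) x = x \<longleftrightarrow> x \<in> {r, s}" if "x \<in> darts T" for x
  proof (cases x rule: dart_cases)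
    case bud
    then have "mate x \<noteq> x" using pos_mate[of x] by (metis less_irrefl)
    then show ?thesis using rs opp_closure_bud[OF bud] bud by auto
  next
    case (mate b)
    then have "b \<noteq> x" using pos_mate[of b] by (metis less_irrefl)
    moreover have "x \<notin> {r, s}" using rs mate by blast
    ultimately show ?thesis using opp_closure_mate[of b] mate by auto
  next
    case other
    have "opp T x = x \<longleftrightarrow> x \<in> half_edges T" using that by (simp add: half_edges_def)
    then show ?thesis using other half_edges_eq by (auto simp: opp_closure_other)
  qed
  moreover have "{r, s} \<subseteq> darts T" using r_leaf q_leaf leaf_in by auto
  ultimately show ?thesis unfolding half_edges_def by auto
qed

lemma contour_closure_perm: "contour (tree_closure T) permutes darts T"
  unfolding contour_def using permutes_compose[OF opp_closure_perm rot_perm] by simp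

lemma contour_closure_permutation: "permutation (contour (tree_closure T))"
  using fin contour_closure_perm by (auto simp: permutation_permutes)

section \<open>Heights and the faces of the closure\<close>

lemma nest:
  assumes "b \<in> buds T" "b' \<in> buds T" "b \<noteq> b'"
  shows "pos (mate b) < pos b' \<or> pos (mate b') < pos b \<or>
    (pos b < pos b' \<and> pos (mate b') < pos (mate b)) \<or>
    (pos b' < pos b \<and> pos (mate b) < pos (mate b'))"
proof -
  have "pos b \<noteq> pos b'" "pos (mate b) \<noteq> pos b'" "pos (mate b') \<noteq> pos b"
    using assms(3) pos_inj[OF bud_in bud_in, OF assms(1,2)]
      pos_inj[OF mate_in bud_in, OF assms(1,2)] pos_inj[OF mate_in bud_in, OF assms(2,1)]
      bud_leaf_distinct[OF assms(2) mate_leaf[OF assms(1)]]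
      bud_leaf_distinct[OF assms(1) mate_leaf[OF assms(2)]] by auto
  then show ?thesis
    using matched_nest[OF matched_mate matched_mate, OF assms(1,2)]
      matched_nest[OF matched_mate matched_mate, OF assms(2,1)]
    by linarith
qed

text \<open>The bounds are half-open so that a bud counts as outside its own pair and the matched
  leaf as inside: crossing the fused edge from bud to leaf enters the new face. This is what makes
  \<open>encl\<close> constant on the faces of the closure.\<close>

definition encl :: "nat \<Rightarrow> nat set" where
  "encl x = {b \<in> buds T. pos b < pos x \<and> pos x \<le> pos (mate b)}"

definition height :: "nat \<Rightarrow> nat" where
  "height x = card (encl x)"

lemma fin_encl [simp]: "finite (encl x)"
  by (simp add: encl_def)

lemma encl_contour:
  assumes "x \<in> darts T"
  shows "encl (contour T x) = {b \<in> buds T. pos b \<le> pos x \<and> pos x < pos (mate b)}"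
proof (cases "contour T x = s")
  case True
  have "\<not> pos x < pos (mate b)" if "b \<in> buds T" for b
    using pos_last[OF True assms mate_in[OF that]] by simp
  then show ?thesis unfolding True by (auto simp: encl_def)
next
  case False
  then show ?thesis using pos_step[OF assms False] by (auto simp: encl_def)
qed

lemma encl_mate:
  assumes "b \<in> buds T"
  shows "encl (mate b) = insert b (encl b)" "b \<notin> encl b"
proof -
  have "b' \<in> encl (mate b) \<longleftrightarrow> b' \<in> insert b (encl b)" for b'
    using assms nest[of b b'] pos_mate[of b] pos_mate[of b']
    by (cases "b = b'") (auto simp: encl_def)
  then show "encl (mate b) = insert b (encl b)" by blast
qed (simp add: encl_def)

lemma encl_base: "encl s = {}"
  by (simp add: encl_def)

text \<open>The contour of the closure jumps from a bud to just after its leaf, and from a leaf back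
  to just after its bud. By nesting, only whole pairs are skipped.\<close>

lemma encl_closure:
  assumes "x \<in> darts T"
  shows "encl (contour (tree_closure T) x) = encl x"
proof (cases x rule: dart_cases)
  case bud
  have "pos b \<le> pos (mate x) \<and> pos (mate x) < pos (mate b) \<longleftrightarrow> pos b < pos x \<and> pos x \<le> pos (mate b)"
    if "b \<in> buds T" for b
    using nest[of x b] pos_mate[of x] pos_mate[of b] bud that by (cases "b = x") auto
  then show ?thesis
    unfolding contour_closure_bud[OF bud] encl_contour[OF mate_in[OF bud]] by (auto simp: encl_def)
next
  case (mate b)
  have "pos c \<le> pos b \<and> pos b < pos (mate c) \<longleftrightarrow> c \<in> insert b (encl b)"
    if "c \<in> buds T" for c
    using pos_mate[of c] that mate mate_in[of c] bud_in[of b] bud_in[of c] pos_inj[of c b]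
      pos_inj[of "mate c" b] mate_leaf[of c] bud_leaf_distinct[of b T "mate c"]
    by (cases "c = b") (auto simp: encl_def)
  then show ?thesis
    using mate(1) encl_mate(1)[OF mate(1)]
    unfolding mate(2) contour_closure_mate[OF mate(1)] encl_contour[OF bud_in[OF mate(1)]]
    by (auto simp: encl_def[of b])
next
  case other
  have "pos b \<le> pos x \<and> pos x < pos (mate b) \<longleftrightarrow> pos b < pos x \<and> pos x \<le> pos (mate b)"
    if "b \<in> buds T" for b
    using other that pos_inj[of b x] pos_inj[of "mate b" x] assms mate_in bud_in
    by (metis imageI le_eq_less_or_eq)
  then show ?thesis
    unfolding contour_closure_other[OF other] encl_contour[OF assms] by (auto simp: encl_def)
qed

lemma encl_orbit: "y \<in> orbit (contour (tree_closure T)) x \<Longrightarrow> x \<in> darts T \<Longrightarrow> encl y = encl x"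
proof (induction rule: orbit.induct)
  case (step y)
  moreover have "y \<in> darts T"
    using permutes_orbit_subset[OF contour_closure_perm] step by blast
  ultimately show ?case using encl_closure by simp
qed (rule encl_closure)

text \<open>Along a face of the closure the position grows, except after a matched leaf and on the
  return to \<open>s\<close>. So the walk along any face runs into one of these.\<close>

lemma orbit_closure_rep:
  "x \<in> darts T \<Longrightarrow> s \<in> orbit (contour (tree_closure T)) x \<or>
     (\<exists>b\<in>buds T. mate b \<in> orbit (contour (tree_closure T)) x)"
proof (induction "card (darts T) - pos x" arbitrary: x rule: less_induct)
  case less
  let ?g = "contour (tree_closure T)"
  note perm = contour_closure_permutation
  have *: ?case if "?g x = s \<or> pos x < pos (?g x)"
  proof (cases "?g x = s")
    case True
    then show ?thesis using orbit.base[of ?g x] by metis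
  next
    case False
    have gx: "?g x \<in> darts T" using permutes_in_image[OF contour_closure_perm] less.prems by simp
    then have "card (darts T) - pos (?g x) < card (darts T) - pos x"
      using that False pos_less_card[OF gx] by linarith
    from less.hyps[OF this gx] show ?thesis using permutation_orbit_step[OF perm] by simp
  qed
  show ?case
  proof (cases x rule: dart_cases)
    case bud
    then have "?g x = s \<or> pos x < pos (?g x)"
      using pos_step[OF mate_in[OF bud]] pos_mate[OF bud] contour_closure_bud[OF bud] by force
    then show ?thesis by (rule *)
  next
    case (mate b)
    then show ?thesis using permutation_self_in_orbit[OF perm, of x] by blast
  next
    case other
    then have "?g x = s \<or> pos x < pos (?g x)"
      using pos_step[of x] less.prems by (auto simp: contour_closure_other)
    then show ?thesis by (rule *)
  qed
qed

lemma orbit_closure_outer: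
  "x \<in> darts T \<Longrightarrow> encl x = {} \<Longrightarrow> s \<in> orbit (contour (tree_closure T)) x"
  using orbit_closure_rep[of x] encl_orbit[of _ x] encl_mate(1) by (metis insert_not_empty)

lemma orbit_closure_inner:
  assumes "x \<in> darts T" "encl x \<noteq> {}"
  obtains b where "b \<in> buds T" "mate b \<in> orbit (contour (tree_closure T)) x"
    "encl x = insert b (encl b)" "b \<notin> encl b"
  using orbit_closure_rep[OF assms(1)] encl_orbit[OF _ assms(1)] encl_mate assms(2) encl_base
  by metis

lemma height_base: "height s = 0"
  by (simp add: height_def encl_base)

lemma height_mate: "b \<in> buds T \<Longrightarrow> height (mate b) = Suc (height b)"
  by (simp add: height_def encl_mate)

lemma height_closure: "x \<in> darts T \<Longrightarrow> height (contour (tree_closure T) x) = height x"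
  by (simp add: height_def encl_closure)

text \<open>A pair around the root leaf would have to supply it with a partner. With
  \<open>orbit_closure_outer\<close>, both legs therefore lie on the same face of the
  closure.\<close>

lemma encl_root: "encl r = {}"
proof (rule ccontr)
  assume "encl r \<noteq> {}"
  then obtain b where b: "b \<in> buds T" "pos b < pos r" "pos r \<le> pos (mate b)"
    by (auto simp: encl_def)
  have "r \<noteq> mate b" using r_unmatched matched_mate b by metis
  then have "pos r \<noteq> pos (mate b)" using pos_inj r_leaf leaf_in mate_in b by blast
  then have "r \<in> between T b (mate b)"
    using between_matched[OF matched_mate] b r_leaf by (auto simp: leaves_def)
  then show False
    using matchedD(3)[OF matched_mate] b r_unmatched matchedD(1) r_leaf bud_leaf_distinct by metis
qed

text \<open>There is the outer face and one face just inside each pair. If two pairs shared their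
  face, each would enclose the bud of the other.\<close>

lemma card_faces_closure: "card (faces (tree_closure T)) = Suc (card (buds T))"
proof -
  let ?o = "orbit (contour (tree_closure T))"
  note eq = orbit_eq_if_in_orbit[OF contour_closure_permutation]
  note self = permutation_self_in_orbit[OF contour_closure_permutation]
  have faces: "faces (tree_closure T) = insert (?o s) ((\<lambda>b. ?o (mate b)) ` buds T)"
  proof
    show "faces (tree_closure T) \<subseteq> insert (?o s) ((\<lambda>b. ?o (mate b)) ` buds T)"
    proof
      fix F assume "F \<in> faces (tree_closure T)"
      then obtain x where x: "x \<in> darts T" "F = ?o x" by (auto simp: faces_def)
      then show "F \<in> insert (?o s) ((\<lambda>b. ?o (mate b)) ` buds T)"
        using orbit_closure_rep[OF x(1)] eq[of _ x] by blast
    qed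
  qed (use q_in mate_in in \<open>auto simp: faces_def\<close>)
  have outer: "?o s \<noteq> ?o (mate b)" if "b \<in> buds T" for b
    using encl_orbit[of s "mate b"] mate_in[OF that] encl_mate[OF that] encl_base self[of s] by auto
  have "inj_on (\<lambda>b. ?o (mate b)) (buds T)"
  proof (rule inj_onI, rule ccontr)
    fix b c assume bc: "b \<in> buds T" "c \<in> buds T" "?o (mate b) = ?o (mate c)" "b \<noteq> c"
    then have "encl (mate b) = encl (mate c)"
      using encl_orbit[of "mate b" "mate c"] mate_in self by auto
    then have "insert b (encl b) = insert c (encl c)" using bc encl_mate by simp
    then have "b \<in> insert c (encl c)" "c \<in> insert b (encl b)" by (metis insertI1)+
    then have "b \<in> encl c" "c \<in> encl b" using bc(4) by auto
    then show False by (simp add: encl_def)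
  qed
  then have "card ((\<lambda>b. ?o (mate b)) ` buds T) = card (buds T)" by (rule card_image)
  moreover have "?o s \<notin> (\<lambda>b. ?o (mate b)) ` buds T"
  proof
    assume "?o s \<in> (\<lambda>b. ?o (mate b)) ` buds T"
    then obtain b where "?o s = ?o (mate b)" "b \<in> buds T" by (rule imageE)
    then show False using outer by metis
  qed
  ultimately show ?thesis
    unfolding faces by (metis card_insert_disjoint finite_imageI fin_buds)
qed

text \<open>Each pair adds one edge and one face to the tree, so Euler's formula is preserved, and
  the contour of the tree still connects all darts.\<close>

lemma leg_map_closure: "leg_map 2 (tree_closure T)"
proof -
  let ?M = "tree_closure T"
  have card_half: "card (half_edges T) = 2 + 2 * card (buds T)"
  proof -
    have "buds T \<inter> mate ` buds T = {}" using mate_leaf bud_leaf_distinct by blast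
    moreover have "r \<notin> buds T \<union> mate ` buds T" "s \<notin> buds T \<union> mate ` buds T"
      using mate_image' r_leaf q_leaf bud_leaf_distinct by blast+
    ultimately show ?thesis
      unfolding half_edges_eq using s_root card_image[OF mate_inj] by (simp add: card_Un_disjoint)
  qed
  have "2 * card (edges ?M) + card (half_edges ?M) = card (darts T)"
    using card_edges[of ?M] fin opp_closure_perm opp_opp_closure by simp
  then have "2 * card (edges ?M) + 2 = card (darts T)"
    using s_root by (simp add: half_edges_closure)
  moreover have "2 * card (edges T) + card (half_edges T) = card (darts T)"
    using card_edges[of T] fin opp_perm by simp
  ultimately have E: "card (edges ?M) = card (edges T) + card (buds T)"
    using card_half by simp
  have V: "vertices ?M = vertices T" by (simp add: vertices_def)
  have euler': "card (vertices ?M) + card (faces ?M) = card (edges ?M) + 2"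
    unfolding V E card_faces_closure using euler tree by (simp add: plane_tree_def)
  have conn': "connected_map ?M"
  proof (rule connected_map_if_cyclic)
    fix x assume "x \<in> darts ?M"
    show "contour T x = rot ?M x \<or> contour T x = rot ?M (opp ?M x)"
      using opp_bud[of x] opp_leaf[OF mate_leaf]
      by (cases x rule: dart_cases) (auto simp: contour_def opp_closure_other)
  qed (use rot_perm opp_closure_perm contour_orbit in auto)
  have ow: "opp ?M d \<in> white T \<longleftrightarrow> d \<notin> white T" if "d \<in> darts T" "opp ?M d \<noteq> d" for d
  proof (cases d rule: dart_cases)
    case bud
    then show ?thesis using mate_leaf[of d] by (auto simp: opp_closure_bud buds_def leaves_def)
  next
    case (mate b)
    then show ?thesis using mate_leaf[of b] by (auto simp: opp_closure_mate buds_def leaves_def)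
  next
    case other
    then show ?thesis using that opp_white by (auto simp: opp_closure_other)
  qed
  have "r \<in> orbit (contour ?M) r"
    by (rule permutation_self_in_orbit[OF contour_closure_permutation])
  moreover have "s \<in> orbit (contour ?M) r"
    using orbit_closure_outer[OF _ encl_root] r_leaf leaf_in by blast
  ultimately have "bipartite_map ?M"
    unfolding bipartite_map_def half_edges_closure
    using fin rot_perm opp_closure_perm opp_opp_closure white_sub rot_white ow conn' euler' by auto
  moreover have "{r, s} \<subseteq> white T" using r_leaf q_leaf by (auto simp: leaves_def)
  ultimately show ?thesis
    using s_root by (auto simp: leg_map_def leaves_def buds_def half_edges_closure Int_absorb2)
qed

end

text \<open>The walk is based at the root here just to count the single leaves; the second one found
  becomes the base point from then on.\<close>

lemma (in tree_map) charge2_tree_ex: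
  assumes "balanced T" "total_charge T = 2"
  shows "\<exists>s. charge2_tree T s"
proof -
  interpret single_tree T "root_dart T"
    by unfold_locales (use assms in \<open>simp add: balanced_def\<close>)
  have "card (single_leaves T) = 2" using card_single_leaves assms by simp
  then obtain s where "single_leaves T = {root_dart T, s}" "s \<noteq> root_dart T"
    using single unfolding card_2_iff by (metis insertE insert_commute singletonD)
  then show ?thesis by (intro exI[of _ s]) unfold_locales
qed

lemma (in charge2_tree) balanced: "balanced T" and total_charge_2: "total_charge T = 2"
  using singles s_root card_single_leaves by (auto simp: balanced_def)

section \<open>Charges and heights\<close>

lemma (in bip_map) subtree_charge:
  assumes d: "d \<in> darts M" "opp M d \<noteq> d" and S: "component (cut M d) d = S"
    and oS: "opp M d \<notin> S" and sub: "S \<subseteq> darts M"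
  shows "darts (subtree M d) = S"
    and "charge (subtree M d) = int (card (leaves M \<inter> S)) - int (card (buds M \<inter> S))"
proof -
  have dS: "d \<in> S" using component_self[of d "cut M d"] S by simp
  have st: "subtree M d = \<lparr>darts = S, rot = perm_restrict (rot M) S,
      opp = perm_restrict (opp (cut M d)) S, white = white M \<inter> S, root_dart = d\<rparr>"
    by (simp add: subtree_def Let_def S)
  have oc: "opp (cut M d) x = (if x = d \<or> x = opp M d then x else opp M x)" for x
    by (simp add: cut_def)
  show "darts (subtree M d) = S" by (simp add: st)
  have half: "half_edges (subtree M d) = insert d (half_edges M \<inter> S)"
    using d dS oS sub by (auto simp: half_edges_def st perm_restrict_def oc)
  have root: "root_dart (subtree M d) = d" and white: "white (subtree M d) = white M \<inter> S"
    by (simp_all add: st)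
  have dh: "d \<notin> half_edges M" using d by (auto simp: half_edges_def)
  have "leaves (subtree M d) - {d} = leaves M \<inter> S" "buds (subtree M d) - {d} = buds M \<inter> S"
    using dh by (auto simp: leaves_def buds_def half white)
  then show "charge (subtree M d) = int (card (leaves M \<inter> S)) - int (card (buds M \<inter> S))"
    by (simp add: charge_def root)
qed

context charge2_tree
begin

text \<open>A bud before \<open>x\<close> either encloses \<open>x\<close> or has its leaf before
  \<open>x\<close> too. So the height is the excess of buds over matched leaves before
  \<open>x\<close>, which links it to charges.\<close>

lemma height_count:
  "card {b \<in> buds T. pos b < pos x} = height x + card {l \<in> leaves T - {r, s}. pos l < pos x}"
proof -
  let ?A = "{b \<in> buds T. pos (mate b) < pos x}"
  have "mate ` ?A = {l \<in> mate ` buds T. pos l < pos x}" by auto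
  then have "card ?A = card {l \<in> leaves T - {r, s}. pos l < pos x}"
    using card_image[OF inj_on_subset[OF mate_inj], of ?A] unfolding mate_image' by auto
  moreover have "{b \<in> buds T. pos b < pos x} = encl x \<union> ?A"
    using pos_mate by (auto simp: encl_def intro: less_trans)
  moreover have "encl x \<inter> ?A = {}" by (auto simp: encl_def)
  ultimately show ?thesis by (simp add: height_def card_Un_disjoint)
qed

abbreviation interval :: "nat \<Rightarrow> nat \<Rightarrow> nat set" where
  "interval u v \<equiv> {z \<in> darts T. pos u < pos z \<and> pos z \<le> pos v}"

text \<open>Since \<open>u\<close> and \<open>v\<close> are not half-edges, strict and weak bounds
  count the same elements of \<open>A\<close>.\<close>

lemma interval_split:
  assumes "A \<subseteq> half_edges T" "u \<in> darts T" "v \<in> darts T" "u \<notin> half_edges T" "v \<notin> half_edges T"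
    and "pos u < pos v"
  shows "card {a \<in> A. pos a < pos v} = card {a \<in> A. pos a < pos u} + card (A \<inter> interval u v)"
proof -
  have "finite A" using assms(1) fin_half by (rule finite_subset)
  have *: "pos a \<noteq> pos u" "pos a \<noteq> pos v" "a \<in> darts T" if "a \<in> A" for a
    using that assms pos_inj[of a] half_sub by blast+
  have "pos a < pos v \<longleftrightarrow> pos a < pos u \<or> a \<in> interval u v" if "a \<in> A" for a
    using *[OF that] assms(6) by auto
  then have "{a \<in> A. pos a < pos v} = {a \<in> A. pos a < pos u} \<union> (A \<inter> interval u v)"
    by blast
  moreover have "{a \<in> A. pos a < pos u} \<inter> (A \<inter> interval u v) = {}" by auto
  ultimately show ?thesis using \<open>finite A\<close> by (simp add: card_Un_disjoint)
qed

lemma interval_charge: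
  assumes "u \<in> darts T" "v \<in> darts T" "u \<notin> half_edges T" "v \<notin> half_edges T" "pos u < pos v"
  shows "int (card (leaves T \<inter> interval u v)) - int (card (buds T \<inter> interval u v)) =
    int (height u) - int (height v) + (if r \<in> interval u v then 1 else 0)"
proof -
  have "s \<notin> interval u v" by simp
  then have "leaves T \<inter> interval u v =
      (leaves T - {r, s}) \<inter> interval u v \<union> (if r \<in> interval u v then {r} else {})"
    using r_leaf by auto
  then have "card (leaves T \<inter> interval u v) =
      card ((leaves T - {r, s}) \<inter> interval u v) + (if r \<in> interval u v then 1 else 0)"
    by (cases "r \<in> interval u v") simp_all
  moreover have "leaves T - {r, s} \<subseteq> half_edges T" "buds T \<subseteq> half_edges T"
    by (auto simp: leaves_def buds_def)
  note interval_split[OF this(1) assms] interval_split[OF this(2) assms]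
  ultimately show ?thesis using height_count[of u] height_count[of v] by simp
qed

lemma component_cut_before:
  assumes "x \<in> darts T" "y = opp T x" "pos x < pos y"
  shows "component (cut T x) x = darts T - interval x y" "component (cut T y) y = interval x y"
  using component_cut[OF assms(1) assms(2)[symmetric] assms(3)] by auto

text \<open>The side of \<open>y\<close> is an interval of the walk. Its charge is a difference of
  heights, plus 1 if it contains \<open>r\<close>, which heights ignore. The other side has the rest
  of the total charge 2.\<close>

lemma charge_before:
  assumes x: "x \<in> darts T" "opp T x = y" "pos x < pos y"
  shows "darts (subtree T y) = interval x y"
    and "darts (subtree T x) = darts T - interval x y"
    and "r \<notin> interval x y \<Longrightarrow> charge (subtree T y) = int (height x) - int (height y)"
    and "r \<in> interval x y \<Longrightarrow> charge (subtree T x) = 1 - int (height x) + int (height y)"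
proof -
  have y: "y \<in> darts T" "opp T y = x" using x by auto
  have ne: "x \<noteq> y" using x by auto
  then have h: "x \<notin> half_edges T" "y \<notin> half_edges T" using x y by (auto simp: half_edges_def)
  note comp = component_cut_before[OF x(1) x(2)[symmetric] x(3)]
  note cy = subtree_charge[OF y(1) _ comp(2)]
  note cx = subtree_charge[OF x(1) _ comp(1)]
  note ic = interval_charge[OF x(1) y(1) h x(3)]
  show "darts (subtree T y) = interval x y" using cy y ne by auto
  show "darts (subtree T x) = darts T - interval x y" using cx x y ne by auto
  show "charge (subtree T y) = int (height x) - int (height y)" if "r \<notin> interval x y"
    using cy ic that y ne by auto
  show "charge (subtree T x) = 1 - int (height x) + int (height y)" if "r \<in> interval x y"
  proof -
    have c: "card (A \<inter> (darts T - interval x y)) = card A - card (A \<inter> interval x y)"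
      "card (A \<inter> interval x y) \<le> card A" if "A \<subseteq> half_edges T" for A
    proof -
      have "finite A" using that fin_half by (rule finite_subset)
      moreover have "A \<inter> (darts T - interval x y) = A - A \<inter> interval x y" using that half_sub by auto
      ultimately show "card (A \<inter> (darts T - interval x y)) = card A - card (A \<inter> interval x y)"
        "card (A \<inter> interval x y) \<le> card A"
        by (simp_all add: card_Diff_subset card_mono)
    qed
    have "leaves T \<subseteq> half_edges T" "buds T \<subseteq> half_edges T" by (auto simp: leaves_def buds_def)
    note cc = c[OF this(1)] c[OF this(2)]
    have "charge (subtree T x) = int (card (leaves T \<inter> (darts T - interval x y)))
        - int (card (buds T \<inter> (darts T - interval x y)))"
      using cx x y ne by auto
    then show ?thesis using cc ic that total_charge_2 by (simp add: total_charge_def)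
  qed
qed

text \<open>Whichever side of an edge is the lower one, its charge rule says the same about the heights.\<close>
lemma blossom_iff:
  "blossom_tree T \<longleftrightarrow> (\<forall>x\<in>darts T - white T. opp T x \<noteq> x \<longrightarrow>
     (if pos x < pos (opp T x) then height (opp T x) \<le> height x
      else height (opp T x) \<le> Suc (height x)))"
    (is "_ \<longleftrightarrow> (\<forall>x\<in>_. _ \<longrightarrow> ?ok x)")
proof -
  have rule: "(r \<notin> darts (subtree T x) \<longrightarrow> charge_rule T x) \<and>
      (r \<notin> darts (subtree T (opp T x)) \<longrightarrow> charge_rule T (opp T x)) \<longleftrightarrow> ?ok x"
    if x: "x \<in> darts T - white T" "opp T x \<noteq> x" for x
  proof -
    let ?y = "opp T x"
    have xD: "x \<in> darts T" and yD: "?y \<in> darts T" and white: "x \<notin> white T" "?y \<in> white T"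
      using x opp_white[of x] by auto
    have rD: "r \<in> darts T" using r_leaf leaf_in by blast
    have "pos x \<noteq> pos ?y" using pos_inj xD yD x by metis
    then consider (xy) "pos x < pos ?y" | (yx) "pos ?y < pos x" by linarith
    then show ?thesis
    proof cases
      case xy
      \<comment> \<open>The rule is \<open>0 \<le> height x - height ?y\<close> if the white side is
        the lower one, and \<open>1 - height x + height ?y \<le> 1\<close> if the black side
        is.\<close>
      note c = charge_before[OF xD refl xy]
      show ?thesis
        using c(3,4) xy white rD unfolding c(1,2) charge_rule_def by auto
    next
      case yx
      \<comment> \<open>The rule is \<open>height ?y - height x \<le> 1\<close> if the black side is
        the lower one, and \<open>0 \<le> 1 - height ?y + height x\<close> if the white side
        is.\<close>
      note c = charge_before[OF yD opp_opp yx]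
      show ?thesis
        using c(3,4) yx white rD unfolding c(1,2) charge_rule_def by auto
    qed
  qed
  show ?thesis
  proof
    assume "blossom_tree T"
    then have "\<And>d. d \<in> darts T \<Longrightarrow> opp T d \<noteq> d \<Longrightarrow> r \<notin> darts (subtree T d) \<Longrightarrow> charge_rule T d"
      by (simp add: blossom_tree_def)
    then show "\<forall>x\<in>darts T - white T. opp T x \<noteq> x \<longrightarrow> ?ok x"
      using rule opp_opp opp_in by (metis Diff_iff)
  next
    assume ok: "\<forall>x\<in>darts T - white T. opp T x \<noteq> x \<longrightarrow> ?ok x"
    have "charge_rule T d" if d: "d \<in> darts T" "opp T d \<noteq> d" "r \<notin> darts (subtree T d)" for d
    proof (cases "d \<in> white T")
      case True
      then have "opp T d \<in> darts T - white T" "opp T (opp T d) \<noteq> opp T d"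
        using d opp_white[of d] by auto
      note od = this
      have "?ok (opp T d)" using ok od by blast
      then have "r \<notin> darts (subtree T (opp T (opp T d))) \<longrightarrow> charge_rule T (opp T (opp T d))"
        using rule[OF od] by blast
      then show ?thesis using d(3) unfolding opp_opp by blast
    next
      case False
      then have "?ok d" using ok d by blast
      then show ?thesis using rule[of d] False d by blast
    qed
    then show "blossom_tree T" using tree by (simp add: blossom_tree_def)
  qed
qed

text \<open>With \<open>height_opp_closure\<close> below, this identifies \<open>height\<close> with the directed distance from the
  outer face in the dual of the closure.\<close>
lemma height_maximal:
  assumes blossom: "blossom_tree T"
    and k: "k s = 0" "\<And>x. x \<in> darts T \<Longrightarrow> k (contour (tree_closure T) x) = k x"
      "\<And>x. x \<in> darts T - white T \<Longrightarrow> k (opp (tree_closure T) x) \<le> Suc (k x)"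
    and x: "x \<in> darts T"
  shows "k x \<le> height x"
  using x
proof (induction "height x" arbitrary: x rule: less_induct)
  case less
  have korb: "k y = k x" if "y \<in> orbit (contour (tree_closure T)) x" for y
    using that
  proof (induction rule: orbit.induct)
    case base
    then show ?case using k(2) less.prems by simp
  next
    case (step y)
    moreover have "y \<in> darts T"
      using permutes_orbit_subset[OF contour_closure_perm] step less.prems by blast
    ultimately show ?case using k(2) by simp
  qed
  show ?case
  proof (cases "encl x = {}")
    case True
    then show ?thesis using orbit_closure_outer[OF less.prems True] korb[of s] k(1) by simp
  next
    case False
    then obtain b where b: "b \<in> buds T" "mate b \<in> orbit (contour (tree_closure T)) x"
        "encl x = insert b (encl b)" "b \<notin> encl b"
      by (rule orbit_closure_inner[OF less.prems])
    \<comment> \<open>The face of \<open>x\<close> is entered from the bud \<open>b\<close>, one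
      level below, and \<open>k\<close> grows by at most one across that edge.\<close>
    then have "height x = Suc (height b)" by (simp add: height_def)
    then have "k b \<le> height b" using less.hyps bud_in b by simp
    moreover have "k (mate b) \<le> Suc (k b)"
      using k(3)[of b] b bud_in by (simp add: opp_closure_bud buds_def)
    ultimately show ?thesis using korb[OF b(2)] \<open>height x = Suc (height b)\<close> by simp
  qed
qed

text \<open>From a bud to its leaf the height rises by exactly one, at an edge of the tree the
  charge rule bounds the rise, and a black dart is never a matched leaf.\<close>

lemma height_opp_closure:
  assumes "blossom_tree T" "x \<in> darts T - white T"
  shows "height (opp (tree_closure T) x) \<le> Suc (height x)"
proof (cases x rule: dart_cases)
  case bud
  then show ?thesis by (simp add: opp_closure_bud height_mate)
next
  case (mate b)
  then show ?thesis using assms mate_leaf[of b] by (simp add: leaves_def)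
next
  case other
  then show ?thesis using assms blossom_iff
    by (cases "opp T x = x") (auto simp: opp_closure_other split: if_splits)
qed

end

section \<open>Isomorphisms and uniqueness\<close>

definition iso_via :: "(nat \<Rightarrow> nat) \<Rightarrow> bmap \<Rightarrow> bmap \<Rightarrow> bool" where
  "iso_via f M N \<longleftrightarrow> bij_betw f (darts M) (darts N) \<and>
     (\<forall>d\<in>darts M. f (rot M d) = rot N (f d) \<and> f (opp M d) = opp N (f d) \<and>
                  (f d \<in> white N \<longleftrightarrow> d \<in> white M)) \<and>
     f (root_dart M) = root_dart N"

lemma map_iso_iff:
  "(M, N) \<in> map_iso \<longleftrightarrow> bipartite_map M \<and> bipartite_map N \<and> (\<exists>f. iso_via f M N)"
  by (simp add: map_iso_def iso_via_def)

lemma iso_viaD: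
  assumes "iso_via f M N"
  shows "bij_betw f (darts M) (darts N)" "inj_on f (darts M)" "f ` darts M = darts N"
    "d \<in> darts M \<Longrightarrow> f d \<in> darts N"
    "d \<in> darts M \<Longrightarrow> f (rot M d) = rot N (f d)"
    "d \<in> darts M \<Longrightarrow> f (opp M d) = opp N (f d)"
    "d \<in> darts M \<Longrightarrow> f d \<in> white N \<longleftrightarrow> d \<in> white M"
    "f (root_dart M) = root_dart N"
  using assms by (auto simp: iso_via_def bij_betw_def)

lemma iso_via_inv:
  assumes "iso_via f M N" "bipartite_map M" "bipartite_map N"
  shows "iso_via (inv_into (darts M) f) N M"
proof -
  interpret M: bip_map M by unfold_locales (rule assms)
  interpret N: bip_map N by unfold_locales (rule assms)
  note f = iso_viaD[OF assms(1)]
  let ?g = "inv_into (darts M) f"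
  have g: "?g (f d) = d" if "d \<in> darts M" for d using f(2) that by simp
  have "?g (rot N e) = rot M (?g e) \<and> ?g (opp N e) = opp M (?g e) \<and> (?g e \<in> white M \<longleftrightarrow> e \<in> white N)"
    if e: "e \<in> darts N" for e
  proof -
    obtain d where "d \<in> darts M" "e = f d" using e f(3) by blast
    then show ?thesis using f(5-7)[symmetric] g by simp
  qed
  moreover have "bij_betw ?g (darts N) (darts M)" using f(1) by (rule bij_betw_inv_into)
  moreover have "?g (root_dart N) = root_dart M" using f(8)[symmetric] g M.root_in by simp
  ultimately show ?thesis by (simp add: iso_via_def)
qed

lemma equiv_map_iso: "equiv {M. bipartite_map M} map_iso"
proof (rule equivI)
  show "map_iso \<subseteq> {M. bipartite_map M} \<times> {M. bipartite_map M}"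
    by (auto simp: map_iso_iff)
  have "iso_via id M M" for M by (simp add: iso_via_def)
  then show "refl_on {M. bipartite_map M} map_iso"
    by (auto simp: refl_on_def map_iso_iff)
  show "sym map_iso"
    using iso_via_inv by (auto simp: sym_def map_iso_iff)
  have "iso_via (g \<circ> f) M K" if "iso_via f M N" "iso_via g N K" for f g M N K
    using iso_viaD[OF that(1)] iso_viaD[OF that(2)] bij_betw_trans
    unfolding iso_via_def by (metis comp_apply)
  then show "trans map_iso"
    unfolding trans_def map_iso_iff by blast
qed

lemma degree_distribution_iso:
  assumes "(M, N) \<in> map_iso"
  shows "degree_distribution M = degree_distribution N"
proof -
  obtain f where f: "iso_via f M N" using assms by (auto simp: map_iso_iff)
  interpret M: bip_map M by unfold_locales (use assms in \<open>simp add: map_iso_iff\<close>)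
  interpret N: bip_map N by unfold_locales (use assms in \<open>simp add: map_iso_iff\<close>)
  note fD = iso_viaD[OF f]
  have sub: "v \<subseteq> darts M" if "v \<in> vertices M" for v
    using that permutes_orbit_subset[OF M.rot_perm] by (auto simp: vertices_def)
  have orb: "f ` orbit (rot M) d = orbit (rot N) (f d)" if d: "d \<in> darts M" for d
  proof (rule orbit_inverse)
    show "d \<in> orbit (rot M) d"
      using M.fin M.rot_perm by (intro permutation_self_in_orbit) (auto simp: permutation_permutes)
    show "rot N (f x) = f (rot M x)" if x: "x \<in> orbit (rot M) d" for x
      using fD(5)[OF subsetD[OF permutes_orbit_subset[OF M.rot_perm d] x]] by simp
  qed
  have "vertices N = (\<lambda>d. orbit (rot N) (f d)) ` darts M"
    unfolding vertices_def fD(3)[symmetric] by (simp add: image_image)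
  also have "\<dots> = (\<lambda>d. f ` orbit (rot M) d) ` darts M"
    by (intro image_cong) (simp_all add: orb)
  finally have vN: "vertices N = (`) f ` vertices M"
    by (simp add: vertices_def image_image)
  have inj: "inj_on ((`) f) (vertices M)"
    using inj_on_image_Pow[OF fD(2)] by (rule inj_on_subset) (use sub in auto)
  have W: "f ` v \<subseteq> white N \<longleftrightarrow> v \<subseteq> white M" "f ` v \<inter> white N = {} \<longleftrightarrow> v \<inter> white M = {}"
    if "v \<in> vertices M" for v
    using sub[OF that] fD(7) by auto
  have img: "image_mset card (mset_set {v \<in> vertices N. Q v}) = image_mset card (mset_set {v \<in> vertices M. P v})"
    if PQ: "\<And>v. v \<in> vertices M \<Longrightarrow> Q (f ` v) \<longleftrightarrow> P v" for P Q
  proof -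
    have fv: "finite {v \<in> vertices M. P v}" using M.fin_vertices by simp
    have "{v \<in> vertices N. Q v} = (`) f ` {v \<in> vertices M. P v}" using PQ vN by auto
    then have "mset_set {v \<in> vertices N. Q v} = image_mset ((`) f) (mset_set {v \<in> vertices M. P v})"
      using inj by (subst image_mset_mset_set) (auto elim: inj_on_subset)
    then have "image_mset card (mset_set {v \<in> vertices N. Q v}) =
        image_mset (\<lambda>v. card (f ` v)) (mset_set {v \<in> vertices M. P v})"
      by (simp add: multiset.map_comp comp_def)
    also have "\<dots> = image_mset card (mset_set {v \<in> vertices M. P v})"
    proof (rule image_mset_cong)
      fix v assume "v \<in># mset_set {v \<in> vertices M. P v}"
      then have "v \<subseteq> darts M" using sub fv by auto
      then show "card (f ` v) = card v" using fD(2) by (meson card_image inj_on_subset)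
    qed
    finally show ?thesis .
  qed
  show ?thesis unfolding degree_distribution_def using img W by simp
qed

lemma matched_iso:
  assumes "iso_via f M N" "bipartite_map M" "bipartite_map N" "matched M b l"
  shows "matched N (f b) (f l)"
proof -
  interpret M: bip_map M by unfold_locales (rule assms)
  interpret N: bip_map N by unfold_locales (rule assms)
  note f = iso_viaD[OF assms(1)]
  have inj: "f x = f y \<longleftrightarrow> x = y" if "x \<in> darts M" "y \<in> darts M" for x y
    using f(2) that by (auto dest: inj_onD)
  have half: "f d \<in> half_edges N \<longleftrightarrow> d \<in> half_edges M" if "d \<in> darts M" for d
    using that f(4) f(6)[OF that, symmetric] inj by (auto simp: half_edges_def)
  have buds: "f d \<in> buds N" if "d \<in> buds M" for d
    using that half f(7) by (auto simp: buds_def half_edges_def)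
  have leaves: "f d \<in> leaves N" if "d \<in> leaves M" for d
    using that half f(7) by (auto simp: leaves_def half_edges_def)
  have contour: "f (contour M d) = contour N (f d)" if "d \<in> darts M" for d
    using that f(5,6) by (simp add: contour_def)
  have in_pow: "(contour M ^^ n) d \<in> darts M" if "d \<in> darts M" for n d
    using that by (induction n) auto
  have pow: "f ((contour M ^^ n) d) = (contour N ^^ n) (f d)" if "d \<in> darts M" for n d
    using that in_pow by (induction n) (auto simp: contour)
  have dist: "funpow_dist1 (contour N) (f x) (f y) = funpow_dist1 (contour M) x y"
    if "x \<in> darts M" "y \<in> darts M" for x y
  proof -
    have "(contour N ^^ n) (contour N (f x)) = f y \<longleftrightarrow> (contour M ^^ n) (contour M x) = y" for n
      using that inj in_pow by (simp add: contour[symmetric] pow[symmetric])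
    then show ?thesis by (simp add: funpow_dist_def)
  qed
  have between: "between N (f x) (f y) = f ` between M x y"
    if xy: "x \<in> darts M" "y \<in> darts M" for x y
  proof -
    have "between M x y \<subseteq> darts M" using M.half_sub by (auto simp: between_def)
    show ?thesis
    proof (intro set_eqI iffI)
      fix z assume "z \<in> between N (f x) (f y)"
      then obtain n where n: "0 < n" "n < funpow_dist1 (contour M) x y"
          "z = (contour N ^^ n) (f x)" "z \<in> half_edges N"
        unfolding between_def dist[OF xy] by blast
      then have "z = f ((contour M ^^ n) x)" using pow xy by simp
      then show "z \<in> f ` between M x y"
        using n half[OF in_pow[OF xy(1)]] unfolding between_def by blast
    next
      fix z assume "z \<in> f ` between M x y"
      then obtain n where n: "0 < n" "n < funpow_dist1 (contour M) x y"
          "z = f ((contour M ^^ n) x)" "(contour M ^^ n) x \<in> half_edges M"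
        unfolding between_def by blast
      then show "z \<in> between N (f x) (f y)"
        using half[OF in_pow[OF xy(1)]] pow[OF xy(1)] unfolding between_def dist[OF xy] by auto
    qed
  qed
  show ?thesis using assms(4)
  proof (induction rule: matched.induct)
    case (1 b l)
    then have "b \<in> darts M" "l \<in> darts M" by (auto simp: buds_def leaves_def half_edges_def)
    then show ?case using 1 by (intro matched.intros) (auto simp: between buds leaves)
  qed
qed

section \<open>Closures of isomorphic trees\<close>

locale tree_pair = A: charge2_tree T1 s1 + B: charge2_tree T2 s2 for T1 s1 T2 s2
begin

lemma closure_iso:
  assumes f: "iso_via f T1 T2"
  shows "iso_via f (tree_closure T1) (tree_closure T2)"
proof -
  note fD = iso_viaD[OF f]
  have buds: "f d \<in> buds T2 \<longleftrightarrow> d \<in> buds T1" if d: "d \<in> darts T1" for d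
  proof -
    have "opp T2 (f d) = f d \<longleftrightarrow> opp T1 d = d"
      using fD(2) fD(6)[OF d] d A.opp_in by (metis inj_onD)
    then show ?thesis using d fD(4,7) by (auto simp: buds_def half_edges_def)
  qed
  have mate: "f (A.mate b) = B.mate (f b)" if "b \<in> buds T1" for b
    using matched_iso[OF f A.bip B.bip A.matched_mate[OF that]] by (simp add: B.matched_iff)
  have "f (opp (tree_closure T1) d) = opp (tree_closure T2) (f d)" if d: "d \<in> darts T1" for d
  proof (cases d rule: A.dart_cases)
    case bud
    then show ?thesis using buds[OF d] mate by (simp add: A.opp_closure_bud B.opp_closure_bud)
  next
    case (mate b)
    then show ?thesis using buds[of b] A.bud_in \<open>\<And>b. b \<in> buds T1 \<Longrightarrow> f (A.mate b) = B.mate (f b)\<close>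
      by (simp add: A.opp_closure_mate B.opp_closure_mate)
  next
    case other
    have "f d \<notin> B.mate ` buds T2"
    proof
      assume "f d \<in> B.mate ` buds T2"
      then obtain c where c: "c \<in> buds T2" "f d = B.mate c" by blast
      then obtain b where b: "b \<in> darts T1" "c = f b" using fD(3) B.bud_in by blast
      then have "f d = f (A.mate b)" "b \<in> buds T1" using c buds mate by auto
      then show False using other d A.mate_in fD(2) by (metis imageI inj_onD)
    qed
    then show ?thesis
      using other buds[OF d] fD(6)[OF d] by (simp add: A.opp_closure_other B.opp_closure_other)
  qed
  then show ?thesis using f by (simp add: iso_via_def)
qed

end

section \<open>Trees with isomorphic closures\<close>

locale closure_pair = tree_pair +
  fixes f
  assumes blossom1: "blossom_tree T1" and blossom2: "blossom_tree T2"
    and iso: "iso_via f (tree_closure T1) (tree_closure T2)"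
begin

lemmas fD = iso_viaD[OF iso, simplified]

lemma f_inj: "x \<in> darts T1 \<Longrightarrow> y \<in> darts T1 \<Longrightarrow> f x = f y \<longleftrightarrow> x = y"
  using fD(2) by (auto dest: inj_onD)

lemma bip_closure: "bipartite_map (tree_closure T1)" "bipartite_map (tree_closure T2)"
  using A.leg_map_closure B.leg_map_closure by (auto simp: leg_map_def)

lemma sym: "closure_pair T2 s2 T1 s1 (inv_into (darts T1) f)"
  using iso_via_inv[OF iso bip_closure] blossom1 blossom2
  by unfold_locales simp_all

lemma f_s: "f s1 = s2"
proof -
  have "s1 \<in> half_edges (tree_closure T1)" by (simp add: A.half_edges_closure)
  then have "s1 \<in> darts T1" "opp (tree_closure T1) s1 = s1" by (auto simp: half_edges_def)
  then have "f s1 \<in> half_edges (tree_closure T2)"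
    using fD(4) fD(6)[of s1] by (simp add: half_edges_def)
  moreover have "f s1 \<noteq> B.r"
    using f_inj[of s1 A.r] fD(8) A.s_root \<open>s1 \<in> darts T1\<close> A.root_in by simp
  ultimately show ?thesis by (simp add: B.half_edges_closure)
qed

text \<open>The heights of \<open>T2\<close>, pulled back along \<open>f\<close>, satisfy the
  conditions on \<open>k\<close> in \<open>height_maximal\<close>. The same holds with the trees
  exchanged, whence equality.\<close>

lemma height_le: "x \<in> darts T1 \<Longrightarrow> B.height (f x) \<le> A.height x"
proof (rule A.height_maximal[OF blossom1])
  show "B.height (f s1) = 0" by (simp add: f_s B.height_base)
  have opp: "opp (tree_closure T1) x \<in> darts T1" if "x \<in> darts T1" for x
    using that permutes_in_image[OF A.opp_closure_perm] by simp
  then have "f (contour (tree_closure T1) x) = contour (tree_closure T2) (f x)" if "x \<in> darts T1" for x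
    using that fD(5,6) by (simp add: contour_def)
  then show "B.height (f (contour (tree_closure T1) x)) = B.height (f x)" if "x \<in> darts T1" for x
    using that B.height_closure fD(4) by simp
  show "B.height (f (opp (tree_closure T1) x)) \<le> Suc (B.height (f x))"
    if "x \<in> darts T1 - white T1" for x
    using that B.height_opp_closure[OF blossom2, of "f x"] fD(4,6,7) by simp
qed

lemma height_eq:
  assumes "x \<in> darts T1"
  shows "B.height (f x) = A.height x"
proof -
  interpret sym: closure_pair T2 s2 T1 s1 "inv_into (darts T1) f" by (rule sym)
  show ?thesis
    using height_le[OF assms] sym.height_le[of "f x"] fD(2,4) assms by simp
qed

definition agree :: "nat \<Rightarrow> bool" where
  "agree n \<longleftrightarrow> (\<forall>i\<le>n. f ((contour T1 ^^ i) s1) = (contour T2 ^^ i) s2)"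

lemma card_eq: "card (darts T1) = card (darts T2)"
  using fD(1) by (rule bij_betw_same_card)

lemma agree_pos:
  assumes "agree n" "x \<in> darts T1" "A.pos x \<le> n"
  shows "B.pos (f x) = A.pos x"
proof -
  have "f x = (contour T2 ^^ A.pos x) s2"
    using assms A.funpow_pos[OF assms(2)] unfolding agree_def by metis
  then show ?thesis
    using B.pos_funpow_less_card[of "A.pos x"] A.pos_less_card[OF assms(2)] card_eq by simp
qed

lemma agree_pos':
  assumes "agree n" "x \<in> darts T1" "B.pos (f x) \<le> n"
  shows "A.pos x = B.pos (f x)"
proof -
  let ?j = "B.pos (f x)"
  have "f x = (contour T2 ^^ ?j) s2" using B.funpow_pos[of "f x"] fD(4) assms by simp
  also have "\<dots> = f ((contour T1 ^^ ?j) s1)" using assms by (simp add: agree_def)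
  finally have "x = (contour T1 ^^ ?j) s1" using f_inj assms(2) A.q_in by simp
  then show ?thesis
    using A.pos_funpow_less_card[of ?j] B.pos_less_card[of "f x"] fD(4) assms(2) card_eq by metis
qed

text \<open>As \<open>rot\<close> is injective, agreement at the next dart shows that both walks
  treated the edge at \<open>x\<close> in the same way.\<close>

lemma agree_half:
  assumes ag: "agree n" and x: "x \<in> darts T1" "A.pos x < n"
  shows "f (opp T1 x) = opp T2 (f x)"
proof -
  have fx: "f ((contour T1 ^^ i) s1) = (contour T2 ^^ i) s2" if "i \<le> n" for i
    using ag that by (simp add: agree_def)
  have "f (contour T1 x) = contour T2 (f x)"
    using fx[of "A.pos x"] fx[of "Suc (A.pos x)"] x by simp
  then have "rot T2 (f (opp T1 x)) = rot T2 (opp T2 (f x))"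
    using fD(5)[of "opp T1 x"] x by (simp add: contour_def)
  then show ?thesis using permutes_inj[OF B.rot_perm] by (auto dest: injD)
qed

text \<open>For a bud, the contrary would leave an edge in \<open>T2\<close> that raises the height
  by one, so the charge rule would have its white end met first. As the walks agree so far, the leaf
  would then precede its bud in \<open>T1\<close>. For a matched leaf, the bud was met earlier,
  where the trees already agree, and in \<open>T2\<close> it is cut together with its partner in the
  closure.\<close>

lemma half_step:
  assumes ag: "agree (A.pos x)" and x: "x \<in> darts T1" and half: "x \<in> half_edges T1"
  shows "f x \<in> half_edges T2"
proof -
  consider "x = A.r" | "x = s1" | (bud) "x \<in> buds T1" | (mate) b where "b \<in> buds T1" "x = A.mate b"
    using half A.half_edges_eq by blast
  then show ?thesis
  proof cases
    case 1
    then show ?thesis using fD(8) B.root_half by simp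
  next
    case 2
    then show ?thesis using f_s B.half_edges_eq by simp
  next
    case bud
    let ?y = "A.mate x"
    have y: "?y \<in> darts T1" using A.mate_in bud by simp
    have fy: "opp (tree_closure T2) (f x) = f ?y"
      using fD(6)[OF x] bud by (simp add: A.opp_closure_bud)
    show ?thesis
    proof (rule ccontr)
      assume nh: "f x \<notin> half_edges T2"
      then have "f x \<notin> buds T2" "f x \<notin> B.mate ` buds T2" using B.half_edges_eq by auto
      then have oy: "opp T2 (f x) = f ?y" using fy B.opp_closure_other by simp
      moreover have fxD: "f x \<in> darts T2 - white T2" using x bud fD(4,7) by (simp add: buds_def)
      moreover have "f ?y \<noteq> f x" using f_inj[OF y x] A.pos_mate[OF bud] by auto
      moreover have "B.height (f ?y) = Suc (B.height (f x))"
        using height_eq x y A.height_mate[OF bud] by simp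
      ultimately have "\<not> B.pos (f x) < B.pos (f ?y)"
        using blossom2 B.blossom_iff by (metis Suc_n_not_le_n)
      then have "B.pos (f ?y) \<le> A.pos x" using agree_pos[OF ag x] by simp
      then have "A.pos ?y \<le> A.pos x" using agree_pos'[OF ag y] by simp
      then show False using A.pos_mate[OF bud] by simp
    qed
  next
    case (mate b)
    have b: "b \<in> darts T1" "A.pos b < A.pos x" "opp T1 b = b"
      using mate A.bud_in A.pos_mate A.opp_bud by auto
    have "opp T2 (f b) = f b" using agree_half[OF ag b(1,2)] b(3) by simp
    then have "f b \<in> half_edges T2" using fD(4) b by (simp add: half_edges_def)
    moreover have fx: "opp (tree_closure T2) (f b) = f x"
      using fD(6)[OF b(1)] mate by (simp add: A.opp_closure_bud)
    moreover have "f x \<noteq> f b" using f_inj[OF x b(1)] b(2) by auto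
    then have "f b \<notin> half_edges (tree_closure T2)" using fx by (auto simp: half_edges_def)
    ultimately have "f b \<in> buds T2 \<union> B.mate ` buds T2"
      using B.half_edges_eq B.half_edges_closure by auto
    then have "opp (tree_closure T2) (f b) \<in> buds T2 \<union> B.mate ` buds T2"
      by (auto simp: B.opp_closure_bud B.opp_closure_mate)
    then show ?thesis using fx B.half_edges_eq by auto
  qed
qed

lemma half_iff:
  assumes ag: "agree (A.pos x)" and x: "x \<in> darts T1"
  shows "f x \<in> half_edges T2 \<longleftrightarrow> x \<in> half_edges T1"
proof
  assume half: "f x \<in> half_edges T2"
  let ?g = "inv_into (darts T1) f"
  \<comment> \<open>Agreement up to \<open>x\<close> passes to the inverse of \<open>f\<close>, so
    \<open>half_step\<close> applies with the trees exchanged.\<close>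
  interpret sym: closure_pair T2 s2 T1 s1 ?g by (rule sym)
  have "sym.agree (B.pos (f x))"
    unfolding sym.agree_def
  proof (intro allI impI)
    fix i assume "i \<le> B.pos (f x)"
    then have "i \<le> A.pos x" using agree_pos[OF ag x] by simp
    then have "f ((contour T1 ^^ i) s1) = (contour T2 ^^ i) s2" using ag by (simp add: agree_def)
    then show "?g ((contour T2 ^^ i) s2) = (contour T1 ^^ i) s1"
      using fD(2) A.q_in by (metis A.funpow_in inv_into_f_f)
  qed
  from sym.half_step[OF this _ half] show "x \<in> half_edges T1" using x fD(2,4) by simp
qed (rule half_step[OF ag x])

lemma opp_step:
  assumes ag: "agree (A.pos x)" and x: "x \<in> darts T1"
  shows "f (opp T1 x) = opp T2 (f x)"
proof (cases "x \<in> half_edges T1")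
  case True
  then show ?thesis using half_iff[OF ag x] by (simp add: half_edges_def)
next
  case False
  then have "f x \<notin> half_edges T2" using half_iff[OF ag x] by simp
  then show ?thesis
    using False fD(6)[OF x] A.half_edges_eq B.half_edges_eq
    by (simp add: A.opp_closure_other B.opp_closure_other)
qed

text \<open>The two contour walks can only diverge at a dart that is cut in one tree and not in the other,
  and the charge rules exclude this.\<close>
lemma agree_all: "n < card (darts T1) \<Longrightarrow> agree n"
proof (induction n)
  case 0
  then show ?case by (simp add: agree_def f_s)
next
  case (Suc n)
  let ?x = "(contour T1 ^^ n) s1"
  have x: "?x \<in> darts T1" using A.q_in by simp
  have px: "A.pos ?x = n" using A.pos_funpow_less_card Suc.prems by simp
  have ag: "agree n" using Suc by simp
  then have fx: "f ?x = (contour T2 ^^ n) s2" by (simp add: agree_def)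
  have "f (contour T1 ?x) = contour T2 (f ?x)"
    using opp_step[of ?x] ag px x fD(5)[of "opp T1 ?x"] by (simp add: contour_def)
  then have "f ((contour T1 ^^ Suc n) s1) = (contour T2 ^^ Suc n) s2" using fx by simp
  then show ?case using ag by (auto simp: agree_def le_Suc_eq simp del: funpow.simps)
qed

lemma trees_iso: "iso_via f T1 T2"
  using iso opp_step agree_all A.pos_less_card unfolding iso_via_def by simp

end

section \<open>Opening a 2-leg map\<close>

locale two_leg_map = bip_map M for M +
  fixes s
  assumes half: "half_edges M = {root_dart M, s}" and s_root: "s \<noteq> root_dart M"
    and half_white: "half_edges M \<subseteq> white M"
begin

abbreviation r where "r \<equiv> root_dart M"

abbreviation black where "black \<equiv> darts M - white M"

lemma s_in: "s \<in> darts M" using half half_sub by blast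

lemma black_opp: "x \<in> black \<Longrightarrow> opp M x \<in> white M \<and> opp M x \<noteq> x \<and> opp M x \<notin> half_edges M"
  using opp_white[of x] half_white by (auto simp: half_edges_def)

lemma contour_white:
  "x \<in> darts M \<Longrightarrow> contour M x \<in> white M \<longleftrightarrow> x \<notin> white M \<or> x \<in> half_edges M"
  using rot_white[of "opp M x"] opp_white[of x] half_white
  by (auto simp: contour_def half_edges_def)

text \<open>A face contour alternates between black and white darts except at the two legs. So a union of
  faces that contains the legs and is closed under crossing edges from black to white has as many
  white as black darts besides the legs, and is closed under the reverse crossing.\<close>
lemma reach_all:
  assumes "x \<in> darts M"
  shows "\<exists>n. reach (contour M) (opp M) black s n x"
proof -
  define R where "R = {x \<in> darts M. \<exists>n. reach (contour M) (opp M) black s n x}"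
  have finR: "finite R" using fin by (simp add: R_def)
  have sub: "R \<subseteq> darts M" by (auto simp: R_def)
  have step: "contour M x \<in> R" if "x \<in> R" for x
    using that by (auto simp: R_def intro: reach.turn)
  have jump: "opp M x \<in> R" if "x \<in> R" "x \<notin> white M" for x
    using that by (auto simp: R_def intro: reach.jump)
  have sR: "s \<in> R" using s_in by (auto simp: R_def intro: reach.start)
  have orb: "y \<in> R" if "y \<in> orbit (contour M) x" "x \<in> R" for x y
    using that by (induction rule: orbit.induct) (auto intro: step)
  have "s \<in> orbit (contour M) r" using half half_outer by auto
  then have rR: "r \<in> R" using orb sR orbit_sym by blast
  define B where "B = R - white M"
  define W where "W = R \<inter> white M"
  have legs: "{r, s} \<subseteq> W" using sR rR half half_white by (auto simp: W_def)
  have onto: "contour M ` R = R"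
    using finR step by (intro endo_inj_surj) (auto intro: inj_onI)
  have "W = contour M ` (B \<union> {r, s})"
  proof
    show "W \<subseteq> contour M ` (B \<union> {r, s})"
    proof
      fix x assume x: "x \<in> W"
      then obtain y where y: "y \<in> R" "x = contour M y" using onto by (auto simp: W_def)
      then have "y \<in> B \<union> {r, s}" using contour_white[of y] sub x half by (auto simp: B_def W_def)
      then show "x \<in> contour M ` (B \<union> {r, s})" using y by blast
    qed
    show "contour M ` (B \<union> {r, s}) \<subseteq> W"
      using step contour_white sub sR rR half by (auto simp: B_def W_def)
  qed
  moreover have "inj_on (contour M) (B \<union> {r, s})" by (auto intro: inj_onI)
  ultimately have "card W = card (B \<union> {r, s})" by (simp only: card_image)
  also have "\<dots> = card B + 2"
    using legs s_root finR by (subst card_Un_disjoint) (auto simp: B_def W_def)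
  finally have "card (W - {r, s}) = card B"
    using legs s_root by (simp add: card_Diff_subset)
  moreover have "card (opp M ` B) = card B"
    using opp_inj by (intro card_image) (auto intro: inj_onI)
  moreover have "opp M ` B \<subseteq> W - {r, s}"
    using jump black_opp sub half by (auto simp: B_def W_def)
  ultimately have oB: "opp M ` B = W - {r, s}"
    using finR by (intro card_subset_eq) (auto simp: W_def)
  have opp: "opp M x \<in> R" if xR: "x \<in> R" for x
  proof -
    consider "x \<in> B" | "x \<in> {r, s}" | "x \<in> W - {r, s}" using xR by (auto simp: B_def W_def)
    then show ?thesis
    proof cases
      case 2
      then have "x \<in> half_edges M" using half by simp
      then show ?thesis using xR by (simp add: half_edges_def)
    next
      case 3
      then obtain b where "b \<in> B" "x = opp M b" using oB by blast
      then show ?thesis by (simp add: B_def)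
    qed (use jump in \<open>auto simp: B_def\<close>)
  qed
  have rot: "rot M x \<in> R" if "x \<in> R" for x
    using step[OF opp[OF that]] by (simp add: contour_def)
  have "y \<in> R" if "y \<in> component M s" for y
    using that by (induction rule: component_induct) (auto intro: sR opp rot)
  then show ?thesis using assms conn s_in by (auto simp: connected_map_def R_def)
qed

sublocale lv: levels "contour M" "opp M" black "darts M" s
  by unfold_locales (use contour_permutation reach_all in auto)

abbreviation lev :: "nat \<Rightarrow> nat" where "lev \<equiv> lv.lev"

lemma lev_orbit: "x \<in> darts M \<Longrightarrow> y \<in> orbit (contour M) x \<Longrightarrow> lev y = lev x"
  using lv.lev_orbit orbit_in by blast

text \<open>One dart for each inner face, from which the face is entered along a shortest dual path.\<close>
definition entrances :: "nat set \<Rightarrow> bool" where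
  "entrances C \<longleftrightarrow> C \<subseteq> black \<and> (\<forall>c\<in>C. lev (opp M c) = Suc (lev c)) \<and>
     (\<forall>y\<in>darts M. lev y \<noteq> 0 \<longrightarrow> (\<exists>c\<in>C. opp M c \<in> orbit (contour M) y)) \<and>
     (\<forall>c\<in>C. \<forall>c'\<in>C. opp M c' \<in> orbit (contour M) (opp M c) \<longrightarrow> c' = c)"

text \<open>The last jump of a shortest path into a face is an entrance. The choice is made per
  face, not per dart, which gives uniqueness.\<close>

lemma entrances_ex: "\<exists>C. entrances C"
proof -
  define FF where "FF = {orbit (contour M) y |y. y \<in> darts M \<and> lev y \<noteq> 0}"
  have "\<forall>F\<in>FF. \<exists>c. c \<in> black \<and> opp M c \<in> F \<and> lev (opp M c) = Suc (lev c)"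
  proof
    fix F assume "F \<in> FF"
    then obtain y where y: "y \<in> darts M" "lev y \<noteq> 0" "F = orbit (contour M) y"
      by (auto simp: FF_def)
    then obtain k where k: "lev y = Suc k" using not0_implies_Suc by blast
    obtain c where "c \<in> black" "lev c = k" "opp M c \<in> orbit (contour M) y"
      by (rule lv.lev_Suc[OF y(1) k]) auto
    then show "\<exists>c. c \<in> black \<and> opp M c \<in> F \<and> lev (opp M c) = Suc (lev c)"
      using y k lev_orbit[OF y(1)] by auto
  qed
  from bchoice[OF this] obtain e
    where e': "\<forall>F\<in>FF. e F \<in> black \<and> opp M (e F) \<in> F \<and> lev (opp M (e F)) = Suc (lev (e F))" ..
  note e = bspec[OF e']
  have "entrances (e ` FF)"
    unfolding entrances_def
  proof (intro conjI ballI impI)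
    fix y assume "y \<in> darts M" "lev y \<noteq> 0"
    then have F: "orbit (contour M) y \<in> FF" by (auto simp: FF_def)
    show "\<exists>c\<in>e ` FF. opp M c \<in> orbit (contour M) y"
      by (rule bexI[OF _ imageI[OF F]]) (use e[OF F] in simp)
  next
    fix c c' assume c: "c \<in> e ` FF" "c' \<in> e ` FF" "opp M c' \<in> orbit (contour M) (opp M c)"
    obtain F where F: "F \<in> FF" "c = e F" using c(1) by (rule imageE)
    obtain F' where F': "F' \<in> FF" "c' = e F'" using c(2) by (rule imageE)
    have "G = orbit (contour M) (opp M (e G))" if "G \<in> FF" for G
      using e[OF that] that orbit_eqI by (auto simp: FF_def)
    from this[OF F(1)] this[OF F'(1)]
    have "F = orbit (contour M) (opp M c)" "F' = orbit (contour M) (opp M c')"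
      using F F' by simp_all
    then show "c' = c" using F F' orbit_eqI[OF c(3)] by simp
  qed (use e in auto)
  then show ?thesis by blast
qed

definition opened :: "nat set \<Rightarrow> bmap" where
  "opened C = M\<lparr>opp := \<lambda>x. if x \<in> C \<or> opp M x \<in> C then x else opp M x\<rparr>"

lemma opened_simps [simp]:
  "darts (opened C) = darts M" "rot (opened C) = rot M"
  "white (opened C) = white M" "root_dart (opened C) = r"
  "opp (opened C) x = (if x \<in> C \<or> opp M x \<in> C then x else opp M x)"
  by (simp_all add: opened_def)

lemma contour_opened:
  "contour (opened C) x = (if x \<in> C \<or> opp M x \<in> C then contour M (opp M x) else contour M x)"
  by (simp add: contour_def)

end

section \<open>The map cut along a choice of entrances\<close>

locale opened_map = two_leg_map M s for M s +
  fixes C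
  assumes C: "entrances C"
begin

abbreviation T where "T \<equiv> opened C"

lemma C_black: "c \<in> C \<Longrightarrow> c \<in> black" and C_in: "c \<in> C \<Longrightarrow> c \<in> darts M"
  and C_lev: "c \<in> C \<Longrightarrow> lev (opp M c) = Suc (lev c)"
  and C_ex: "y \<in> darts M \<Longrightarrow> lev y \<noteq> 0 \<Longrightarrow> \<exists>c\<in>C. opp M c \<in> orbit (contour M) y"
  and C_unique: "c \<in> C \<Longrightarrow> c' \<in> C \<Longrightarrow> opp M c' \<in> orbit (contour M) (opp M c) \<Longrightarrow> c' = c"
  using C by (auto simp: entrances_def)

lemma C_opp: "c \<in> C \<Longrightarrow> opp M c \<notin> C"
  using black_opp[OF C_black] C_black by blast

lemma fin_C: "finite C"
  using C_in fin by (meson finite_subset subsetI)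

lemma opp_perm_T: "opp T permutes darts M" and opp_opp_T: "opp T (opp T x) = x"
proof -
  show *: "opp T (opp T x) = x" for x by auto
  show "opp T permutes darts M"
  proof (rule involution_permutes)
    fix x assume "x \<notin> darts M"
    then show "opp T x = x" using C_in permutes_not_in[OF opp_perm] by auto
  qed (rule *)
qed

lemma contour_perm_T: "contour T permutes darts M"
  unfolding contour_def using permutes_compose[OF opp_perm_T rot_perm] by simp

lemma contour_permutation_T: "permutation (contour T)"
  using fin contour_perm_T by (auto simp: permutation_permutes)

lemma orbit_sym_T: "y \<in> orbit (contour T) x \<longleftrightarrow> x \<in> orbit (contour T) y"
  using contour_permutation_T permutation_self_in_orbit orbit_swap by metis

text \<open>The entrances arrange the faces in a tree rooted at the outer face, and
  \<open>desc c\<close> marks the darts of all faces at or below the one entered through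
  \<open>c\<close>.\<close>

inductive desc :: "nat \<Rightarrow> nat \<Rightarrow> bool" for c where
  face: "desc c (opp M c)"
| turn: "desc c y \<Longrightarrow> desc c (contour M y)"
| child: "desc c y \<Longrightarrow> y \<in> C \<Longrightarrow> desc c (opp M y)"

lemma desc_orbit: "z \<in> orbit (contour M) y \<Longrightarrow> desc c y \<Longrightarrow> desc c z"
  by (induction rule: orbit.induct) (auto intro: desc.turn)

lemma desc_contour: "desc c (contour M y) \<longleftrightarrow> desc c y"
  using desc_orbit[of y "contour M y" c] permutation_orbit_step[OF contour_permutation] self_orbit
    desc.turn by metis

lemma desc_lev: "desc c y \<Longrightarrow> c \<in> C \<Longrightarrow> y \<in> darts M \<and> Suc (lev c) \<le> lev y"
proof (induction rule: desc.induct)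
  case face
  then show ?case using C_in C_lev by simp
next
  case (turn y)
  then show ?case using lv.lev_turn by simp
next
  case (child y)
  then show ?case using C_lev by simp
qed

lemma desc_entrance:
  "desc c y \<Longrightarrow> c \<in> C \<Longrightarrow> \<exists>c'\<in>C. opp M c' \<in> orbit (contour M) y \<and> (c' = c \<or> desc c c')"
proof (induction rule: desc.induct)
  case (turn y)
  then show ?case using permutation_orbit_step[OF contour_permutation] by simp
qed (use self_orbit in blast)+

text \<open>A face has only one entrance, so apart from \<open>c\<close> itself an entrance into
  this part of the face tree must start inside it.\<close>

lemma desc_opp:
  assumes "desc c (opp M x)" "c \<in> C" "x \<in> C"
  shows "x = c \<or> desc c x"
proof -
  obtain c' where c': "c' \<in> C" "opp M c' \<in> orbit (contour M) (opp M x)" "c' = c \<or> desc c c'"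
    using desc_entrance[OF assms(1,2)] by blast
  then show ?thesis using C_unique[OF assms(3) c'(1,2)] by blast
qed

text \<open>Together with \<open>desc_step\<close>: the contour of the opened map comes to the darts
  below \<open>c\<close> only from \<open>c\<close> and leaves them only from
  \<open>opp M c\<close>. Hence they will form an interval of the walk.\<close>

lemma desc_pred:
  assumes "desc c (contour T x)" "c \<in> C"
  shows "x = c \<or> desc c x"
proof -
  consider "x \<in> C" | "opp M x \<in> C" | "x \<notin> C" "opp M x \<notin> C" by blast
  then show ?thesis
  proof cases
    case 1
    then have "desc c (opp M x)" using assms(1) by (simp add: contour_opened desc_contour)
    then show ?thesis using desc_opp assms(2) 1 by blast
  next
    case 2
    then have "desc c (opp M x)" using assms(1) by (simp add: contour_opened desc_contour)
    then show ?thesis using desc.child[OF _ 2] by simp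
  next
    case 3
    then show ?thesis using assms(1) by (simp add: contour_opened desc_contour)
  qed
qed

lemma desc_step:
  assumes "desc c x" "c \<in> C" "x \<noteq> opp M c"
  shows "desc c (contour T x)"
proof -
  consider "x \<in> C" | "opp M x \<in> C" | "x \<notin> C" "opp M x \<notin> C" by blast
  then show ?thesis
  proof cases
    case 1
    then show ?thesis using desc.child[OF assms(1)] by (simp add: contour_opened desc_contour)
  next
    case 2
    then have "opp M x = c \<or> desc c (opp M x)" using desc_opp[of c "opp M x"] assms by simp
    then have "desc c (opp M x)" using assms(3) by auto
    then show ?thesis using 2 by (simp add: contour_opened desc_contour)
  next
    case 3
    then show ?thesis using assms(1) by (simp add: contour_opened desc_contour)
  qed
qed

lemma desc_enter: "c \<in> C \<Longrightarrow> desc c (contour T c)"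
  by (simp add: contour_opened desc_contour desc.face)

lemma desc_irrefl: "c \<in> C \<Longrightarrow> \<not> desc c c"
  using desc_lev by fastforce

lemma lev_half: "x \<in> half_edges M \<Longrightarrow> lev x = 0"
  using lv.lev_start half half_outer lev_orbit[OF root_in, of s] by auto

lemma desc_half: "c \<in> C \<Longrightarrow> x \<in> half_edges M \<Longrightarrow> \<not> desc c x"
  using desc_lev[of c x] lev_half[of x] by auto

text \<open>Without meeting \<open>opp M c\<close>, the walk from \<open>c\<close> could never leave
  the darts below \<open>c\<close>. But it returns to \<open>c\<close>, whose level is too low to be
  among them.\<close>

lemma opp_in_orbit:
  assumes "c \<in> C"
  shows "opp M c \<in> orbit (contour T) c"
proof (rule ccontr)
  assume no: "opp M c \<notin> orbit (contour T) c"
  have "desc c y" if "y \<in> orbit (contour T) c" for y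
    using that
  proof (induction rule: orbit.induct)
    case (step y)
    then show ?case using desc_step[OF _ assms] no by blast
  qed (rule desc_enter[OF assms])
  then show False
    using permutation_self_in_orbit[OF contour_permutation_T, of c] desc_irrefl[OF assms] by blast
qed

text \<open>Both ends of a cut edge lie on the same orbit, so the orbit of \<open>s\<close> is
  closed under the contour of \<open>M\<close> as well. Induction on the level carries it through
  the entrances into every face.\<close>

lemma orbit_T: "orbit (contour T) s = darts M"
proof
  let ?O = "orbit (contour T) s"
  show "?O \<subseteq> darts M" using permutes_orbit_subset[OF contour_perm_T s_in] .
  have s: "s \<in> ?O" using permutation_self_in_orbit[OF contour_permutation_T] .
  have opp: "opp M c \<in> ?O \<longleftrightarrow> c \<in> ?O" if "c \<in> C" for c
    using opp_in_orbit[OF that] orbit_sym_T orbit_trans by metis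
  have step: "contour M x \<in> ?O" if x: "x \<in> ?O" for x
  proof -
    consider "x \<in> C" | "opp M x \<in> C" | "x \<notin> C" "opp M x \<notin> C" by blast
    then show ?thesis
    proof cases
      case 1
      then have "contour T (opp M x) \<in> ?O" using opp x by (intro orbit.step) blast
      then show ?thesis using 1 by (simp add: contour_opened)
    next
      case 2
      then have "contour T (opp M x) \<in> ?O" using opp[OF 2] x by (intro orbit.step) simp
      then show ?thesis using 2 by (simp add: contour_opened)
    next
      case 3
      then show ?thesis using orbit.step[OF x] by (simp add: contour_opened)
    qed
  qed
  have orb: "y \<in> ?O" if "y \<in> orbit (contour M) x" "x \<in> ?O" for x y
    using that by (induction rule: orbit.induct) (auto intro: step)
  have "y \<in> ?O" if "y \<in> darts M" for y
    using that
  proof (induction "lev y" arbitrary: y)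
    case 0
    then show ?case using lv.lev_0[of y] orb s by simp
  next
    case (Suc k)
    then obtain c where c: "c \<in> C" "opp M c \<in> orbit (contour M) y" using C_ex[of y] by auto
    then have "lev c = k" using C_lev[OF c(1)] lev_orbit[OF Suc.prems c(2)] Suc(2) by simp
    then have "opp M c \<in> ?O" using Suc(1)[of c] opp C_in c by simp
    then show ?case using orb[of y "opp M c"] c(2) orbit_sym by blast
  qed
  then show "darts M \<subseteq> ?O" by blast
qed

lemma half_edges_T: "half_edges T = {r, s} \<union> C \<union> opp M ` C"
proof -
  have "opp T x = x \<longleftrightarrow> x \<in> {r, s} \<union> C \<union> opp M ` C" if "x \<in> darts M" for x
  proof -
    have "opp M x = x \<longleftrightarrow> x \<in> {r, s}" using half that by (auto simp: half_edges_def)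
    moreover have "opp M x \<in> C \<longleftrightarrow> x \<in> opp M ` C" by (metis image_iff opp_opp)
    ultimately show ?thesis by auto
  qed
  moreover have "{r, s} \<union> C \<union> opp M ` C \<subseteq> darts M" using s_in root_in C_in by auto
  ultimately show ?thesis unfolding half_edges_def opened_simps(1) by blast
qed

lemma buds_T: "buds T = C" and leaves_T: "leaves T = {r, s} \<union> opp M ` C"
  using half half_white black_opp[OF C_black] C_black
  by (auto simp: buds_def leaves_def half_edges_T)

lemma card_faces_M: "card (faces M) = Suc (card C)"
proof -
  let ?o = "orbit (contour M)"
  have "faces M = insert (?o s) ((\<lambda>c. ?o (opp M c)) ` C)"
  proof
    show "faces M \<subseteq> insert (?o s) ((\<lambda>c. ?o (opp M c)) ` C)"
    proof
      fix F assume "F \<in> faces M"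
      then obtain y where y: "y \<in> darts M" "F = ?o y" by (auto simp: faces_def)
      show "F \<in> insert (?o s) ((\<lambda>c. ?o (opp M c)) ` C)"
      proof (cases "lev y = 0")
        case True
        then show ?thesis using lv.lev_0[OF y(1)] orbit_eqI y by simp
      next
        case False
        then obtain c where "c \<in> C" "opp M c \<in> ?o y" using C_ex y by blast
        then show ?thesis using orbit_eqI[of "opp M c" y] y by blast
      qed
    qed
  qed (use s_in C_in in \<open>auto simp: faces_def\<close>)
  moreover have "?o s \<notin> (\<lambda>c. ?o (opp M c)) ` C"
  proof
    assume "?o s \<in> (\<lambda>c. ?o (opp M c)) ` C"
    then obtain c where c: "c \<in> C" "?o s = ?o (opp M c)" by blast
    then have "opp M c \<in> ?o s" using self_orbit by simp
    then show False using lev_orbit[OF s_in] C_lev[OF c(1)] lv.lev_start by simp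
  qed
  moreover have "inj_on (\<lambda>c. ?o (opp M c)) C"
    using C_unique self_orbit by (intro inj_onI) blast
  ultimately show ?thesis using fin_C by (simp add: card_image)
qed

text \<open>Opening removes \<open>card C\<close> edges and merges \<open>card C + 1\<close> faces
  into one, so Euler's formula is preserved.\<close>

lemma plane_tree_T: "plane_tree T"
proof -
  have disj1: "C \<inter> opp M ` C = {}" using C_opp by blast
  have disj2: "{r, s} \<inter> (C \<union> opp M ` C) = {}"
  proof -
    have "c \<notin> half_edges M \<and> opp M c \<notin> half_edges M" if "c \<in> C" for c
      using C_black[OF that] black_opp[OF C_black[OF that]] half_white by blast
    then have "x \<notin> half_edges M" if "x \<in> C \<union> opp M ` C" for x
      using that by (elim UnE imageE) simp_all
    then show ?thesis unfolding half by (metis disjoint_iff)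
  qed
  have "inj_on (opp M) C" using opp_inj by (auto intro: inj_onI)
  then have "card (half_edges T) = 2 + 2 * card C"
    using disj1 disj2 fin_C s_root unfolding half_edges_T Un_assoc
    by (subst card_Un_disjoint) (simp_all add: card_Un_disjoint card_image)
  moreover have "2 * card (edges T) + card (half_edges T) = card (darts M)"
    using card_edges[of T] fin opp_perm_T opp_opp_T by simp
  moreover have "2 * card (edges M) + card (half_edges M) = card (darts M)"
    using card_edges[of M] fin opp_perm by simp
  moreover have "card (half_edges M) = 2" using half s_root by simp
  ultimately have E: "card (edges M) = card (edges T) + card C" by simp
  have V: "vertices T = vertices M" by (simp add: vertices_def)
  have cyc: "orbit (contour T) d = darts M" if "d \<in> darts M" for d
    using orbit_eq_if_in_orbit[OF contour_permutation_T, of d s] that orbit_T by simp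
  then have "faces T = {darts M}" using s_in by (auto simp: faces_def)
  then have F: "card (faces T) = 1" by simp
  have "connected_map T"
  proof (rule connected_map_if_cyclic)
    show "rot T permutes darts T" "opp T permutes darts T" using rot_perm opp_perm_T by simp_all
    show "contour T x = rot T x \<or> contour T x = rot T (opp T x)" if "x \<in> darts T" for x
      by (simp add: contour_def)
    show "orbit (contour T) d = darts T" if "d \<in> darts T" for d using cyc that by simp
  qed
  moreover have "opp T d \<in> white M \<longleftrightarrow> d \<notin> white M" if "d \<in> darts M" "opp T d \<noteq> d" for d
    using that opp_white[of d] by (auto split: if_splits)
  moreover have "half_edges T \<subseteq> orbit (contour T) r"
    unfolding cyc[OF root_in] by (auto simp: half_edges_def)
  moreover have "card (vertices T) + card (faces T) = card (edges T) + 2"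
    using E F euler card_faces_M unfolding V by simp
  ultimately have "bipartite_map T"
    unfolding bipartite_map_def
    using fin rot_perm opp_perm_T opp_opp_T white_sub rot_white half_edges_T by auto
  then show ?thesis using F by (simp add: plane_tree_def)
qed

section \<open>The contour walk of the opened map and its matching\<close>

sublocale walk: cyclic_walk "contour T" "darts M" s
  by unfold_locales (use fin contour_perm_T s_in orbit_T in auto)

abbreviation pos where "pos \<equiv> walk.pos"

text \<open>The last premise says that the walk has not passed \<open>opp M c\<close> since
  \<open>c\<close>. It also admits \<open>opp M c\<close> before \<open>c\<close>, a case that
  \<open>pos_entrance\<close> refutes by means of this lemma.\<close>

lemma desc_after:
  "x \<in> darts M \<Longrightarrow> c \<in> C \<Longrightarrow> pos c < pos x \<Longrightarrow> \<not> (pos c < pos (opp M c) \<and> pos (opp M c) < pos x)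
    \<Longrightarrow> desc c x"
proof (induction "pos x" arbitrary: x)
  case (Suc n)
  obtain w where w: "w \<in> darts M" "contour T w = x" using walk.pred_ex Suc.prems by blast
  have "x \<noteq> s" using Suc by auto
  then have pw: "pos w = n" using walk.pos_step[of w] w Suc(2) by auto
  show ?case
  proof (cases "w = c")
    case True
    then show ?thesis using desc_enter[OF Suc.prems(2)] w by simp
  next
    case False
    then have "pos w \<noteq> pos c" using walk.pos_inj w C_in Suc.prems by simp
    then have "pos c < pos w" using Suc pw by linarith
    then have "desc c w" "w \<noteq> opp M c" using Suc pw w by auto
    then show ?thesis using desc_step[of c w] Suc.prems(2) w by simp
  qed
qed simp

text \<open>Otherwise nothing after \<open>c\<close> leads out of the darts below \<open>c\<close>,
  and the walk would arrive at \<open>s\<close> while still among them; but \<open>s\<close> has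
  level 0.\<close>

lemma pos_entrance: "c \<in> C \<Longrightarrow> pos c < pos (opp M c)"
proof (rule ccontr)
  assume c: "c \<in> C" and le: "\<not> pos c < pos (opp M c)"
  obtain w where w: "w \<in> darts M" "contour T w = s" using walk.pred_ex s_in by blast
  have "desc c (contour T w)"
  proof (cases "w = c")
    case True
    then show ?thesis using desc_enter c by simp
  next
    case False
    then have "pos c < pos w"
      using walk.pos_last[OF w(2,1) C_in[OF c]] walk.pos_inj[of c w] w C_in c by auto
    then have "desc c w" "w \<noteq> opp M c" using desc_after[OF w(1) c] le by auto
    then show ?thesis using desc_step c by simp
  qed
  then show False using w desc_half[OF c, of s] half by simp
qed

lemma desc_pos:
  "desc c x \<Longrightarrow> c \<in> C \<Longrightarrow> pos c < pos x \<and> pos x \<le> pos (opp M c)"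
proof (induction "pos x" arbitrary: x)
  case 0
  then have "x = s" using walk.pos_eq_0 desc_lev by metis
  then show ?case using 0 desc_half[of c s] half by simp
next
  case (Suc n)
  have xD: "x \<in> darts M" using Suc.prems desc_lev by blast
  obtain w where w: "w \<in> darts M" "contour T w = x" using walk.pred_ex xD by blast
  have "x \<noteq> s" using Suc by auto
  then have pw: "pos w = n" using walk.pos_step[of w] w Suc(2) by auto
  show ?case
  proof (cases "w = c")
    case True
    then show ?thesis using pw Suc(2) pos_entrance[OF Suc.prems(2)] by simp
  next
    case False
    then have dw: "desc c w" using desc_pred[of c w] w Suc.prems by blast
    \<comment> \<open>After \<open>opp M c\<close> the walk is back on the face of \<open>c\<close>,
      which is not below \<open>c\<close>.\<close>
    have "w \<noteq> opp M c"
    proof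
      assume "w = opp M c"
      then have "desc c (contour M c)" using w Suc.prems by (simp add: contour_opened)
      then show False using desc_contour desc_irrefl Suc.prems by blast
    qed
    then have "pos w \<noteq> pos (opp M c)" using walk.pos_inj w C_in Suc.prems by simp
    then show ?thesis using Suc(1)[of w] dw pw Suc by simp
  qed
qed

lemma desc_iff: "c \<in> C \<Longrightarrow> x \<in> darts M \<Longrightarrow> desc c x \<longleftrightarrow> pos c < pos x \<and> pos x \<le> pos (opp M c)"
  using desc_pos desc_after by auto

lemma between_forward:
  "x \<in> darts M \<Longrightarrow> y \<in> darts M \<Longrightarrow> pos x < pos y \<Longrightarrow>
     between T x y = {h \<in> half_edges T. pos x < pos h \<and> pos h < pos y}"
  unfolding between_def by (subst walk.strictly_between_forward) (auto simp: half_edges_def)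

lemma between_wrap:
  "x \<in> darts M \<Longrightarrow> y \<in> darts M \<Longrightarrow> pos y \<le> pos x \<Longrightarrow>
     between T x y = {h \<in> half_edges T. pos x < pos h \<or> pos h < pos y}"
  unfolding between_def by (subst walk.strictly_between_wrap) (auto simp: half_edges_def)

text \<open>From the inside out: the half-edges in between are below \<open>c\<close>, so none is a
  leg, and they are the ends of nested entrances that are matched already.\<close>

lemma matched_entrance: "c \<in> C \<Longrightarrow> matched T c (opp M c)"
proof (induction "pos (opp M c) - pos c" arbitrary: c rule: less_induct)
  case less
  note c = less.prems
  have cD: "c \<in> darts M" "opp M c \<in> darts M" using C_in c by auto
  have btw: "between T c (opp M c) = {h \<in> half_edges T. pos c < pos h \<and> pos h < pos (opp M c)}"
    using between_forward cD pos_entrance[OF c] by blast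
  have *: "matched T c' (opp M c') \<and> c' \<in> between T c (opp M c) \<and> opp M c' \<in> between T c (opp M c)"
    if c': "c' \<in> C" "c' \<noteq> c" "desc c c'" for c'
  proof -
    have "desc c (opp M c')" using desc.child c' by blast
    then have "pos c < pos c'" "pos (opp M c') \<le> pos (opp M c)" using desc_pos c c' by blast+
    moreover have "pos (opp M c') \<noteq> pos (opp M c)"
      using walk.pos_inj C_in c c' opp_inj by simp
    ultimately have p: "pos c < pos c'" "pos c' < pos (opp M c')" "pos (opp M c') < pos (opp M c)"
      using pos_entrance[OF c'(1)] by auto
    then have "matched T c' (opp M c')" using less.hyps[OF _ c'(1)] by linarith
    then show ?thesis using p c' by (auto simp: btw half_edges_T)
  qed
  show ?case
  proof (rule matched.intros)
    show "\<forall>h\<in>between T c (opp M c). \<exists>h'\<in>between T c (opp M c). matched T h h' \<or> matched T h' h"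
    proof
      fix h assume h: "h \<in> between T c (opp M c)"
      then have hh: "h \<in> half_edges T" and p: "pos c < pos h" "pos h < pos (opp M c)"
        by (auto simp: btw)
      then have d: "desc c h" using desc_iff[OF c, of h] by (auto simp: half_edges_def)
      then have "h \<notin> {r, s}" using desc_half[OF c, of h] half by blast
      then consider "h \<in> C" | c' where "c' \<in> C" "h = opp M c'" using hh half_edges_T by blast
      then show "\<exists>h'\<in>between T c (opp M c). matched T h h' \<or> matched T h' h"
      proof cases
        case 1
        then show ?thesis using *[of h] d p by blast
      next
        case 2
        then have "c' \<noteq> c" "desc c c'" using desc_opp[of c c'] d p c by auto
        then show ?thesis using *[of c'] 2 by blast
      qed
    qed
  qed (use c buds_T leaves_T in auto)
qed

text \<open>By induction the half-edges in between are closed under \<open>opp M\<close>. If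
  \<open>l\<close> came after \<open>opp M b\<close> or the range wrapped around, this would put
  \<open>b\<close> strictly inside; if \<open>l\<close> came before \<open>opp M b\<close>, it would
  put \<open>l\<close> strictly inside.\<close>

lemma matched_opp: "matched T b l \<Longrightarrow> l = opp M b"
proof (induction rule: matched.induct)
  case (1 b l)
  have b: "b \<in> C" and l: "l \<in> {r, s} \<union> opp M ` C" using 1 buds_T leaves_T by auto
  have D: "b \<in> darts M" "opp M b \<in> darts M" "l \<in> darts M"
    using b l C_in s_in root_in by auto
  have closed: "opp M h \<in> between T b l" if "h \<in> between T b l" for h
    using 1(3) that opp_opp by metis
  show ?case
  proof (rule ccontr)
    assume ne: "l \<noteq> opp M b"
    show False
    proof (cases "pos b < pos l")
      case True
      note btw = between_forward[OF D(1,3) True]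
      have "opp M b \<notin> between T b l" using closed[of "opp M b"] btw by auto
      then have "\<not> pos (opp M b) < pos l"
        using pos_entrance[OF b] b unfolding btw half_edges_T by blast
      then have d: "desc b l" using desc_iff[OF b D(3)] True by simp
      then have "l \<notin> {r, s}" using desc_half[OF b, of l] half by blast
      then obtain c where c: "c \<in> C" "l = opp M c" using l by blast
      then have "desc b c" using desc_opp[of b c] d b ne by blast
      then have "c \<in> between T b l"
        using desc_pos[OF _ b] pos_entrance[OF c(1)] c unfolding btw half_edges_T by blast
      then have "l \<in> between T b l" using closed c by simp
      then show False using btw by simp
    next
      case False
      then have btw: "between T b l = {h \<in> half_edges T. pos b < pos h \<or> pos h < pos l}"
        using between_wrap[OF D(1,3)] by simp
      then have "opp M b \<in> between T b l" using pos_entrance[OF b] b by (simp add: half_edges_T)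
      then have "b \<in> between T b l" using closed by fastforce
      then show False using btw False by simp
    qed
  qed
qed

lemma charge2_T: "charge2_tree T s"
proof -
  have "\<not> matched T b l" if "l \<in> {r, s}" for b l
  proof
    assume m: "matched T b l"
    then have "b \<in> C" "l = opp M b" using matchedD(1) buds_T matched_opp by auto
    then show False using black_opp[OF C_black] half that by blast
  qed
  then have "single_leaves T = {r, s}"
    using matched_entrance unfolding single_leaves_def leaves_T by blast
  then show ?thesis using plane_tree_T s_root
    by unfold_locales (auto simp: plane_tree_def)
qed

sublocale tree: charge2_tree T s
  by (rule charge2_T)

lemma closure_T: "tree_closure T = M"
proof -
  have mate: "tree.mate c = opp M c" if "c \<in> C" for c
    using matched_opp[OF tree.matched_mate] that buds_T by simp
  have "opp (tree_closure T) x = opp M x" for x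
  proof (cases x rule: tree.dart_cases)
    case bud
    then show ?thesis using tree.opp_closure_bud mate buds_T by simp
  next
    case (mate b)
    then show ?thesis
      using tree.opp_closure_mate[OF mate(1)] \<open>\<And>c. c \<in> C \<Longrightarrow> tree.mate c = opp M c\<close> buds_T by simp
  next
    case other
    then have "x \<notin> C" "opp M x \<notin> C" using mate buds_T by (auto simp: image_iff)
    then show ?thesis using tree.opp_closure_other[OF other] by simp
  qed
  then show ?thesis by (intro bmap.equality) auto
qed

text \<open>Both functions are constant on the faces of \<open>M\<close>, vanish on the outer face
  and grow by one at each entrance.\<close>

lemma height_lev: "x \<in> darts M \<Longrightarrow> tree.height x = lev x"
proof (induction "lev x" arbitrary: x)
  case 0
  then have "x \<in> orbit (contour M) s" using lv.lev_0[of x] by simp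
  then have "tree.encl x = tree.encl s" using tree.encl_orbit[of x s] s_in by (simp add: closure_T)
  then show ?case using 0 tree.height_base by (simp add: tree.height_def)
next
  case (Suc k)
  then obtain c where c: "c \<in> C" "opp M c \<in> orbit (contour M) x" using C_ex[of x] by auto
  then have "lev c = k" using C_lev[OF c(1)] lev_orbit[OF Suc.prems c(2)] Suc(2) by simp
  then have "tree.height c = k" using Suc(1)[of c] C_in c by simp
  moreover have "tree.mate c = opp M c" using matched_opp[OF tree.matched_mate] c buds_T by simp
  then have "tree.height (opp M c) = Suc (tree.height c)"
    using tree.height_mate[of c] c buds_T by simp
  moreover have "tree.encl (opp M c) = tree.encl x"
    using tree.encl_orbit[of "opp M c" x] c Suc.prems by (simp add: closure_T)
  ultimately show ?case using Suc(2) by (simp add: tree.height_def)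
qed

end

section \<open>The bijection\<close>

text \<open>The distances are subtracted from their maximum to make the wanted trace a minimum for a
  well-founded order.\<close>
definition (in two_leg_map) trace :: "nat set \<Rightarrow> nat list" where
  "trace C = map (\<lambda>i. Max (lev ` darts M) - lev ((contour (opened C) ^^ i) s)) [0..<card (darts M)]"

text \<open>The edge of \<open>x\<close> enters the same face as the entrance \<open>c\<close>, but
  \<open>x\<close> is met before \<open>c\<close>. If \<open>x\<close> replaces \<open>c\<close>,
  the walk is unchanged up to \<open>x\<close>; then the new walk enters the higher face, while the
  old one stays at the level of \<open>x\<close>.\<close>

lemma (in opened_map) exchange:
  assumes x: "x \<in> black" "x \<notin> C" "lev (opp M x) = Suc (lev x)" "pos x < pos (opp M x)"
  shows "\<exists>C'. entrances C' \<and> (trace C', trace C) \<in> lex less_than"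
proof -
  let ?y = "opp M x"
  have xD: "x \<in> darts M" and yD: "?y \<in> darts M" using x by auto
  obtain c where c: "c \<in> C" "opp M c \<in> orbit (contour M) ?y" using C_ex[OF yD] x by auto
  have lc: "lev c = lev x" using C_lev[OF c(1)] lev_orbit[OF yD c(2)] x by simp
  define C' where "C' = insert x (C - {c})"
  have C'in: "C' \<subseteq> black" using C_black x by (auto simp: C'_def)
  have eq: "opp M c' \<in> orbit (contour M) ?y \<longleftrightarrow> c' = c" if "c' \<in> C" for c'
    using C_unique[OF c(1) that] orbit_eqI[OF c(2)] c(2) by auto
  have ent: "entrances C'"
    unfolding entrances_def
  proof (intro conjI ballI impI)
    fix z assume z: "z \<in> darts M" "lev z \<noteq> 0"
    then obtain d where d: "d \<in> C" "opp M d \<in> orbit (contour M) z" using C_ex by blast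
    show "\<exists>c\<in>C'. opp M c \<in> orbit (contour M) z"
    proof (cases "d = c")
      case True
      then have "opp M x \<in> orbit (contour M) z"
        using d(2) c(2) orbit_eqI self_orbit by metis
      then show ?thesis by (auto simp: C'_def)
    next
      case False
      then show ?thesis using d by (auto simp: C'_def)
    qed
  next
    fix a b assume ab: "a \<in> C'" "b \<in> C'" "opp M b \<in> orbit (contour M) (opp M a)"
    then have ba: "opp M a \<in> orbit (contour M) (opp M b)" using orbit_sym by blast
    consider "a = x" "b = x" | "a = x" "b \<in> C - {c}" | "b = x" "a \<in> C - {c}" | "a \<in> C" "b \<in> C"
      using ab by (auto simp: C'_def)
    then show "b = a"
      by cases (use ab ba eq C_unique in auto)
  qed (use C'in C_lev x in \<open>auto simp: C'_def\<close>)
  have dy: "desc c ?y"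
    using desc_orbit[OF _ desc.face] c(2) orbit_sym by blast
  then have py: "pos c < pos ?y" "pos ?y \<le> pos (opp M c)" using desc_pos c by blast+
  \<comment> \<open>The darts below \<open>c\<close> form an interval containing \<open>?y\<close>.
    As \<open>x\<close> has the level of \<open>c\<close>, it is outside this interval, and being
    before \<open>?y\<close> it is before all of it.\<close>
  have "\<not> desc c x" using desc_lev[of c x] c lc by auto
  then have "pos x \<le> pos c" using desc_iff[OF c(1) xD] py x(4) by auto
  moreover have "pos x \<noteq> pos c" using walk.pos_inj[OF xD C_in] c x by auto
  ultimately have xc: "pos x < pos c" by simp
  have opp_x: "opp M x \<notin> C" "opp M x \<notin> C'" using C_black C'in black_opp[OF x(1)] by blast+
  have same: "contour (opened C') z = contour T z" if "z \<in> darts M" "pos z < pos x" for z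
  proof -
    have "z \<noteq> x" "z \<noteq> ?y" "z \<noteq> c" "z \<noteq> opp M c" using that x(4) xc py by auto
    then have "z \<in> C' \<longleftrightarrow> z \<in> C" "opp M z \<in> C' \<longleftrightarrow> opp M z \<in> C"
      using opp_opp by (auto simp: C'_def)
    then show ?thesis by (simp add: contour_opened)
  qed
  have prefix: "(contour (opened C') ^^ i) s = (contour T ^^ i) s" if "i \<le> pos x" for i
    using that
  proof (induction i)
    case (Suc i)
    have "pos ((contour T ^^ i) s) = i" using walk.pos_funpow[OF xD, of i] Suc.prems by simp
    then show ?case using Suc same[of "(contour T ^^ i) s"] s_in by simp
  qed simp
  let ?K = "Max (lev ` darts M)" and ?n = "card (darts M)" and ?m = "Suc (pos x)"
  have "walk.pos ?y < ?n" using walk.pos_less_card yD by simp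
  then have mn: "?m < ?n" using x(4) by simp
  have "(contour T ^^ pos x) s = x" using walk.funpow_pos xD by simp
  then have "(contour T ^^ ?m) s = contour M x" "(contour (opened C') ^^ ?m) s = contour M ?y"
    using prefix[of "pos x"] x(2) opp_x by (simp_all add: contour_opened C'_def)
  then have l: "lev ((contour T ^^ ?m) s) = lev x" "lev ((contour (opened C') ^^ ?m) s) = Suc (lev x)"
    using lv.lev_turn xD yD x(3) by simp_all
  \<comment> \<open>This bound keeps the truncated subtraction strictly decreasing.\<close>
  have "lev ?y \<le> ?K" using yD fin by simp
  then have less: "?K - lev ((contour (opened C') ^^ ?m) s) < ?K - lev ((contour T ^^ ?m) s)"
    using l x(3) by simp
  have "[0..<?n] = [0..<?m] @ ?m # [Suc ?m..<?n]"
    using mn upt_add_eq_append[of 0 ?m "?n - ?m"] upt_conv_Cons[OF mn] by simp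
  then have split: "trace D = map (\<lambda>i. ?K - lev ((contour (opened D) ^^ i) s)) [0..<?m] @
      (?K - lev ((contour (opened D) ^^ ?m) s)) #
      map (\<lambda>i. ?K - lev ((contour (opened D) ^^ i) s)) [Suc ?m..<?n]" for D
    unfolding trace_def by simp
  have pre: "map (\<lambda>i. ?K - lev ((contour (opened C') ^^ i) s)) [0..<?m] =
      map (\<lambda>i. ?K - lev ((contour T ^^ i) s)) [0..<?m]"
    by (intro map_cong) (auto simp: prefix less_Suc_eq_le)
  have "(trace C', trace C) \<in> lex less_than"
    unfolding lex_conv split[of C] split[of C'] pre mem_Collect_eq prod.case
    by (intro conjI exI) (rule refl | use less in simp)+
  then show ?thesis using ent by blast
qed

lemma (in two_leg_map) blossom_tree_ex:
  "\<exists>T. blossom_tree T \<and> balanced T \<and> total_charge T = 2 \<and> tree_closure T = M"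
proof -
  have wf: "wf (inv_image (lex less_than) trace)" by auto
  obtain C0 where C0: "C0 \<in> {C. entrances C}" using entrances_ex by blast
  have "\<exists>C\<in>{C. entrances C}. \<forall>C'. (C', C) \<in> inv_image (lex less_than) trace \<longrightarrow>
      C' \<notin> {C. entrances C}"
    using wf C0 unfolding wf_eq_minimal by meson
  then obtain C where C: "C \<in> {C. entrances C}"
    and min: "\<forall>C'. (C', C) \<in> inv_image (lex less_than) trace \<longrightarrow> C' \<notin> {C. entrances C}" by (rule bexE)
  interpret opened_map M s C by unfold_locales (use C in simp)
  have "blossom_tree T"
    unfolding tree.blossom_iff
  proof (intro ballI impI)
    fix x assume x: "x \<in> darts T - white T" "opp T x \<noteq> x"
    then have xb: "x \<in> black" "x \<notin> C" and ox: "opp T x = opp M x" by (auto split: if_splits)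
    have h: "tree.height x = lev x" "tree.height (opp M x) = lev (opp M x)"
      using height_lev xb by auto
    \<comment> \<open>No edge raises the level by more than one from black to white. So the charge
      rule can fail only at a rise whose black end is met first, and there \<open>exchange\<close>
      would contradict the choice of \<open>C\<close>.\<close>
    have "lev (opp M x) \<le> Suc (lev x)" using lv.lev_jump[of x] xb by simp
    moreover have "\<not> (lev (opp M x) = Suc (lev x) \<and> pos x < pos (opp M x))"
      using exchange[OF xb] min by auto
    ultimately show "if tree.pos x < tree.pos (opp T x) then tree.height (opp T x) \<le> tree.height x
      else tree.height (opp T x) \<le> Suc (tree.height x)"
      unfolding ox h by auto
  qed
  then show ?thesis using tree.balanced tree.total_charge_2 closure_T by blast
qed

lemma two_leg_map_ex:
  assumes "leg_map 2 M"
  shows "\<exists>s. two_leg_map M s"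
proof -
  interpret bip_map M by unfold_locales (use assms in \<open>simp add: leg_map_def\<close>)
  have sub: "half_edges M \<subseteq> white M" and half: "half_edges M = leaves M"
    using assms by (auto simp: leg_map_def buds_def leaves_def)
  then obtain a b where ab: "half_edges M = {a, b}" "a \<noteq> b"
    using assms by (auto simp: leg_map_def card_2_iff)
  then have "\<exists>s. half_edges M = {root_dart M, s} \<and> s \<noteq> root_dart M"
    using root_half by auto
  then obtain s where "half_edges M = {root_dart M, s}" "s \<noteq> root_dart M" by blast
  then have "two_leg_map M s" using sub by unfold_locales
  then show ?thesis by blast
qed

theorem theorem3:
  shows "\<exists>\<Phi>. bij_betw \<Phi> (balanced_blossom_trees 2) (leg_maps 2) \<and>
           (\<forall>C\<in>balanced_blossom_trees 2. \<forall>T\<in>C. \<forall>M\<in>\<Phi> C.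
              degree_distribution M = degree_distribution T)"
proof -
  define P where "P = {T. blossom_tree T \<and> balanced T \<and> total_charge T = 2}"
  define L where "L = {M. leg_map 2 M}"
  note equiv = equiv_map_iso
  have P_tree: "\<exists>s. charge2_tree T s" if "T \<in> P" for T
  proof -
    interpret tree_map T
      by unfold_locales (use that in \<open>auto simp: P_def blossom_tree_def plane_tree_def\<close>)
    show ?thesis using that by (intro charge2_tree_ex) (auto simp: P_def)
  qed
  have P_bip: "bipartite_map T" if "T \<in> P" for T
    using that by (auto simp: P_def blossom_tree_def plane_tree_def)
  have L_bip: "bipartite_map M" if "M \<in> L" for M
    using that by (simp add: L_def leg_map_def)
  have closure: "tree_closure T \<in> L" if "T \<in> P" for T
    using P_tree[OF that] charge2_tree.leg_map_closure by (auto simp: L_def)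
  have iso: "(tree_closure T1, tree_closure T2) \<in> map_iso \<longleftrightarrow> (T1, T2) \<in> map_iso"
    if T: "T1 \<in> P" "T2 \<in> P" for T1 T2
  proof -
    obtain s1 s2 where "charge2_tree T1 s1" "charge2_tree T2 s2" using P_tree T by blast
    then interpret tree_pair T1 s1 T2 s2 by (simp add: tree_pair_def)
    show ?thesis
    proof
      assume "(tree_closure T1, tree_closure T2) \<in> map_iso"
      then obtain f where "iso_via f (tree_closure T1) (tree_closure T2)" by (auto simp: map_iso_iff)
      then interpret closure_pair T1 s1 T2 s2 f
        by unfold_locales (use T in \<open>auto simp: P_def\<close>)
      show "(T1, T2) \<in> map_iso" using trees_iso P_bip T by (auto simp: map_iso_iff)
    next
      assume "(T1, T2) \<in> map_iso"
      then show "(tree_closure T1, tree_closure T2) \<in> map_iso"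
        using closure_iso closure L_bip T by (auto simp: map_iso_iff)
    qed
  qed
  \<comment> \<open>Restricting to representatives in \<open>P\<close> makes \<open>iso\<close>
    applicable without first showing that \<open>P\<close> is invariant under isomorphism. The union
    has only one distinct member.\<close>
  define \<Phi> where "\<Phi> C = (\<Union>T\<in>C \<inter> P. map_iso `` {tree_closure T})" for C
  have \<Phi>: "\<Phi> (map_iso `` {T}) = map_iso `` {tree_closure T}" if T: "T \<in> P" for T
  proof -
    have "T \<in> map_iso `` {T} \<inter> P" using T P_bip equiv_class_self[OF equiv] by auto
    moreover have "map_iso `` {tree_closure T'} = map_iso `` {tree_closure T}"
      if "T' \<in> map_iso `` {T} \<inter> P" for T'
      using that iso[OF T, of T'] equiv_class_eq[OF equiv] by auto
    ultimately show ?thesis unfolding \<Phi>_def by blast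
  qed
  have trees: "balanced_blossom_trees 2 = (\<lambda>T. map_iso `` {T}) ` P"
    by (auto simp: balanced_blossom_trees_def P_def quotient_def)
  have legs: "leg_maps 2 = (\<lambda>M. map_iso `` {M}) ` L"
    by (auto simp: leg_maps_def L_def quotient_def)
  have surj: "\<exists>T\<in>P. tree_closure T = M" if "M \<in> L" for M
    using two_leg_map_ex[of M] two_leg_map.blossom_tree_ex that by (auto simp: L_def P_def)
  have eq_iff: "map_iso `` {M} = map_iso `` {N} \<longleftrightarrow> (M, N) \<in> map_iso"
    if "bipartite_map M" "bipartite_map N" for M N
    using eq_equiv_class_iff[OF equiv] that by simp
  have "inj_on \<Phi> (balanced_blossom_trees 2)"
  proof (rule inj_onI)
    fix C1 C2 assume C: "C1 \<in> balanced_blossom_trees 2" "C2 \<in> balanced_blossom_trees 2" "\<Phi> C1 = \<Phi> C2"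
    then obtain T1 T2 where T: "T1 \<in> P" "C1 = map_iso `` {T1}" "T2 \<in> P" "C2 = map_iso `` {T2}"
      unfolding trees by blast
    then have "(tree_closure T1, tree_closure T2) \<in> map_iso"
      using C(3) \<Phi> eq_iff L_bip closure by simp
    then show "C1 = C2" using T iso eq_iff P_bip by simp
  qed
  moreover have "\<Phi> ` balanced_blossom_trees 2 = leg_maps 2"
  proof
    show "\<Phi> ` balanced_blossom_trees 2 \<subseteq> leg_maps 2"
      unfolding trees legs using \<Phi> closure by auto
    show "leg_maps 2 \<subseteq> \<Phi> ` balanced_blossom_trees 2"
    proof
      fix C assume "C \<in> leg_maps 2"
      then obtain M where M: "M \<in> L" "C = map_iso `` {M}" unfolding legs by blast
      then obtain T where "T \<in> P" "tree_closure T = M" using surj by blast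
      then show "C \<in> \<Phi> ` balanced_blossom_trees 2" unfolding trees using \<Phi> M by auto
    qed
  qed
  ultimately have "bij_betw \<Phi> (balanced_blossom_trees 2) (leg_maps 2)"
    by (simp add: bij_betw_def)
  moreover have "degree_distribution M = degree_distribution T"
    if C: "C \<in> balanced_blossom_trees 2" and TM: "T \<in> C" "M \<in> \<Phi> C" for C T M
  proof -
    obtain T0 where T0: "T0 \<in> P" "C = map_iso `` {T0}" using C unfolding trees by blast
    have "degree_distribution T0 = degree_distribution T"
      using TM(1) T0 degree_distribution_iso by auto
    moreover have "degree_distribution (tree_closure T0) = degree_distribution M"
      using TM(2) T0 \<Phi> degree_distribution_iso by auto
    moreover have "degree_distribution (tree_closure T0) = degree_distribution T0"
      by (simp add: degree_distribution_def vertices_def)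
    ultimately show ?thesis by simp
  qed
  ultimately show ?thesis by blast
qed

end
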